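(* Let $\mathfrak{F}$ be a circuit function class, i.e. $\mathfrak{F}=\mathrm{FAC}^i_{\mathbb{R}}[\mathcal{A}]$ for some $i\in\mathbb{N}$ and some set $\mathcal{A}$ of unary real functions, and let $\mathfrak{F}_s=\mathfrak{F}[\mathrm{sign}]$. Let $(f_n)_{n\in\mathbb{N}}$ and $(f'_n)_{n\in\mathbb{N}}$ be two function families in the recurrent circuit function class $\mathrm{rec}[\mathfrak{F}_s]\text{-}\mathfrak{F}$. Then the family $(f'_{n'}\circ f_n)_{n\in\mathbb{N}}$, where $n'\in\mathbb{N}$ denotes the output dimension of $f_n$, is a function family in $\mathrm{rec}[\mathfrak{F}_s]\text{-}\mathfrak{F}_s$.
   Context: An arithmetic circuit is a finite directed acyclic graph of gates: $n$ ordered input gates (indegree 0), constant gates (indegree 0, labelled by a real constant), arithmetic gates labelled $+$ or $\times$, and $m$ ordered output gates (indegree 1, outdegree 0); it computes $f_C:\mathbb{R}^n\to\mathbb{R}^m$ by evaluating gates in the obvious way. An extended arithmetic circuit additionally has $\ell$ ordered auxiliary memory gates which behave like input gates, so it computes $f_C:\mathbb{R}^n\times\mathbb{R}^\ell\to\mathbb{R}^m$; input and auxiliary memory gates together are called memory gates. Size = number of gates; depth = length of the longest path. For a set $\mathcal{A}$ of functions $\mathbb{R}\to\mathbb{R}$, circuits may additionally use unary gates computing each $f\in\mathcal{A}$. $\mathrm{sign}(x)=1$ if $x>0$ and $0$ otherwise. $\mathrm{FAC}^i_{\mathbb{R}}[\mathcal{A}]$ is the class of functions computed by (extended) circuit families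 $(C_n)_{n\in\mathbb{N}}$ ($C_n$ has $n$ inputs) of size $n^{O(1)}$ and depth $O((\log n)^i)$ using gates from $\mathcal{A}$; such classes are called circuit function classes, and $\mathfrak{F}_s:=\mathfrak{F}[\mathrm{sign}]$. A recurrent arithmetic circuit is a tuple $(C,\bar a,E_{rec},f_{halt},V_{halt})$: $C$ an extended circuit with $n$ inputs, $\ell$ auxiliary memory gates and $m$ outputs; $\bar a\in\mathbb{R}^\ell$ initial values of the auxiliary memory gates; $E_{rec}$ a set of recurrent edges giving exactly one incoming edge (from some gate of $C$) to each memory gate; $V_{halt}$ an ordered set of $p$ gates of $C$ (halting gates); $f_{halt}:\mathbb{N}_{>0}\times\mathbb{R}^p\to\{0,1\}$. On input $\bar x$, $C$ is evaluated with inputs $\bar x$ and auxiliary values $\bar a$; after iteration $i$, if $f_{halt}(i,\text{values of }V_{halt})=1$ the output is the tuple of values of the output gates; otherwise each memory gate takes the value of its recurrent predecessor and $C$ is evaluated again (iteration $i+1$). A recurrent circuit family $(\mathit{rec}\text{-}C_n)_n$ ($n$ inputs) computes $\bar x\mapsto f_{\mathit{rec}\text{-}C_{|\bar x|}}(\bar x)$; its underlying circuits form an extended circuit family; its set of halting functions is $\{f_{halt}^n\}$ (circuits with the same number of halting gates use the same halting function). A function $\mathbb{R}^*\to\mathbb{R}^*$ is in $\mathrm{rec}[\mathfrak{F}_{halt}]\text{-}\mathfrak{F}_C$ if it is computed by a recurrent circuit family whose underlying extended circuit family computes a function in $\mathfrak{F}_C$ and whose set of halting functions is a subset of the functions computed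 by some $\mathfrak{F}_{halt}$-circuit family. *)

theory Defs
  imports "HOL-Library.Landau_Symbols"
begin

section \<open>Extended arithmetic circuits\<close>

datatype gate_label =
    Input
  | Aux
  | Const real
  | Plus
  | Times
  | Unary "real \<Rightarrow> real"
  | Output

text \<open>The three lists carry the orderings of the input, auxiliary memory and output gates. An
  edge \<open>(h, g)\<close> leads from \<open>h\<close> to \<open>g\<close>.\<close>

record circuit =
  gates :: "nat set"
  edges :: "(nat \<times> nat) set"
  label :: "nat \<Rightarrow> gate_label"
  inputs :: "nat list"
  auxs :: "nat list"
  outputs :: "nat list"

definition preds :: "circuit \<Rightarrow> nat \<Rightarrow> nat set" where
  "preds C g = {h. (h, g) \<in> edges C}"

definition gates_labelled :: "circuit \<Rightarrow> gate_label \<Rightarrow> nat set" where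
  "gates_labelled C l = {g \<in> gates C. label C g = l}"

definition memory_gates :: "circuit \<Rightarrow> nat set" where
  "memory_gates C = set (inputs C) \<union> set (auxs C)"

text \<open>Fan-in of \<open>Plus\<close> and \<open>Times\<close> gates is unbounded.\<close>

definition circuit_over :: "(real \<Rightarrow> real) set \<Rightarrow> circuit \<Rightarrow> bool" where
  "circuit_over A C \<longleftrightarrow>
     finite (gates C) \<and> edges C \<subseteq> gates C \<times> gates C \<and> acyclic (edges C) \<and>
     distinct (inputs C) \<and> set (inputs C) = gates_labelled C Input \<and>
     distinct (auxs C) \<and> set (auxs C) = gates_labelled C Aux \<and>
     distinct (outputs C) \<and> set (outputs C) = gates_labelled C Output \<and>
     (\<forall>g \<in> gates C. case label C g of
          Input \<Rightarrow> preds C g = {}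
        | Aux \<Rightarrow> preds C g = {}
        | Const c \<Rightarrow> preds C g = {}
        | Plus \<Rightarrow> True
        | Times \<Rightarrow> True
        | Unary \<phi> \<Rightarrow> \<phi> \<in> A \<and> card (preds C g) = 1
        | Output \<Rightarrow> card (preds C g) = 1 \<and> (\<forall>h. (g, h) \<notin> edges C))"

definition circuit_size :: "circuit \<Rightarrow> nat" where
  "circuit_size C = card (gates C)"

text \<open>A pair in \<open>edges C ^^ k\<close> is the pair of endpoints of a path with \<open>k\<close> edges.\<close>

definition circuit_depth :: "circuit \<Rightarrow> nat" where
  "circuit_depth C = Max {k. edges C ^^ k \<noteq> {}}"

text \<open>Here \<open>\<mu>\<close> assigns values to the memory gates.\<close>

definition gate_op :: "circuit \<Rightarrow> (nat \<Rightarrow> real) \<Rightarrow> (nat \<Rightarrow> real) \<Rightarrow> nat \<Rightarrow> real" where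
  "gate_op C \<mu> val g = (case label C g of
       Input \<Rightarrow> \<mu> g
     | Aux \<Rightarrow> \<mu> g
     | Const c \<Rightarrow> c
     | Plus \<Rightarrow> (\<Sum>h \<in> preds C g. val h)
     | Times \<Rightarrow> (\<Prod>h \<in> preds C g. val h)
     | Unary \<phi> \<Rightarrow> \<phi> (val (the_elem (preds C g)))
     | Output \<Rightarrow> val (the_elem (preds C g)))"

definition gate_val :: "circuit \<Rightarrow> (nat \<Rightarrow> real) \<Rightarrow> nat \<Rightarrow> real" where
  "gate_val C \<mu> = wfrec (edges C) (gate_op C \<mu>)"

lemma wf_edges: "circuit_over A C \<Longrightarrow> wf (edges C)"
  unfolding circuit_over_def
  by (meson finite_SigmaI finite_acyclic_wf finite_subset)

lemma gate_val_rec: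
  assumes C: "circuit_over A C" and g: "g \<in> gates C"
  shows "gate_val C \<mu> g = gate_op C \<mu> (gate_val C \<mu>) g"
proof -
  let ?v = "gate_val C \<mu>"
  let ?c = "cut ?v (edges C) g"
  have rec: "?v g = gate_op C \<mu> ?c g"
    unfolding gate_val_def by (rule wfrec[OF wf_edges[OF C]])
  have cut: "?c h = ?v h" if "h \<in> preds C g" for h
    using that by (simp add: cut_def preds_def)
  have unary: "?c (the_elem (preds C g)) = ?v (the_elem (preds C g))"
    if "card (preds C g) = 1"
    using that cut by (auto simp: card_1_singleton_iff)
  have "gate_op C \<mu> ?c g = gate_op C \<mu> ?v g"
    using C g cut unary
    by (auto simp: gate_op_def circuit_over_def split: gate_label.splits
        intro!: sum.cong prod.cong)
  with rec show ?thesis by simp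
qed

definition load :: "circuit \<Rightarrow> real list \<Rightarrow> real list \<Rightarrow> nat \<Rightarrow> real" where
  "load C x a g = the (map_of (zip (inputs C @ auxs C) (x @ a)) g)"

text \<open>The function \<open>\<real>\<^sup>n \<times> \<real>\<^sup>l \<rightarrow> \<real>\<^sup>m\<close> computed by a circuit; only arguments with
  \<open>length x = length (inputs C)\<close> and \<open>length a = length (auxs C)\<close> are meaningful.\<close>

definition circuit_fun :: "circuit \<Rightarrow> real list \<Rightarrow> real list \<Rightarrow> real list" where
  "circuit_fun C x a = map (gate_val C (load C x a)) (outputs C)"

section \<open>Circuit function classes\<close>

definition sign_fn :: "real \<Rightarrow> real" where
  "sign_fn x = (if x > 0 then 1 else 0)"

text \<open>A circuit function class is represented by the set of its (extended) circuit families.\<close>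

definition FAC :: "nat \<Rightarrow> (real \<Rightarrow> real) set \<Rightarrow> (nat \<Rightarrow> circuit) set" where
  "FAC i A = {C.
     (\<forall>n. circuit_over A (C n) \<and> length (inputs (C n)) = n) \<and>
     (\<exists>k::nat. (\<lambda>n. real (circuit_size (C n))) \<in> O(\<lambda>n. real n ^ k)) \<and>
     (\<lambda>n. real (circuit_depth (C n))) \<in> O(\<lambda>n. ln (real n) ^ i)}"

section \<open>Recurrent arithmetic circuits\<close>

text \<open>Only \<open>halt_fun R i v\<close> with \<open>i > 0\<close> and \<open>length v = length (halt_gates R)\<close> is meaningful.\<close>

record rec_circuit =
  body :: circuit
  init_aux :: "real list"
  rec_edges :: "(nat \<times> nat) set"
  halt_fun :: "nat \<Rightarrow> real list \<Rightarrow> bool"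
  halt_gates :: "nat list"

definition rec_circuit_wf :: "rec_circuit \<Rightarrow> bool" where
  "rec_circuit_wf R \<longleftrightarrow>
     length (init_aux R) = length (auxs (body R)) \<and>
     rec_edges R \<subseteq> gates (body R) \<times> memory_gates (body R) \<and>
     (\<forall>g \<in> memory_gates (body R). \<exists>!h. (h, g) \<in> rec_edges R) \<and>
     distinct (halt_gates R) \<and> set (halt_gates R) \<subseteq> gates (body R)"

text \<open>The values of the memory gates after \<open>t\<close> updates, that is, during iteration \<open>t + 1\<close>.\<close>

primrec memory :: "rec_circuit \<Rightarrow> real list \<Rightarrow> nat \<Rightarrow> nat \<Rightarrow> real" where
  "memory R x 0 = load (body R) x (init_aux R)"
| "memory R x (Suc t) =
     (\<lambda>g. gate_val (body R) (memory R x t) (THE h. (h, g) \<in> rec_edges R))"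

definition iter_val :: "rec_circuit \<Rightarrow> real list \<Rightarrow> nat \<Rightarrow> nat \<Rightarrow> real" where
  "iter_val R x i = gate_val (body R) (memory R x (i - 1))"

definition halts_at :: "rec_circuit \<Rightarrow> real list \<Rightarrow> nat \<Rightarrow> bool" where
  "halts_at R x i \<longleftrightarrow> i > 0 \<and> halt_fun R i (map (iter_val R x i) (halt_gates R))"

definition rec_circuit_fun :: "rec_circuit \<Rightarrow> real list \<Rightarrow> real list option" where
  "rec_circuit_fun R x =
     (if \<exists>i. halts_at R x i
      then Some (map (iter_val R x (LEAST i. halts_at R x i)) (outputs (body R)))
      else None)"

text \<open>
  \<open>rec_class Fh Fc\<close> is the class written \<open>rec[Fh]-Fc\<close>. Its members are families of total
  functions \<open>f n : \<real>\<^sup>n \<rightarrow> \<real>\<^sup>m\<close> (where \<open>m\<close> depends on \<open>n\<close>), so the recurrent circuits have to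
  halt on every input. A halting function with \<open>p\<close> halting gates has \<open>p + 1\<close> real arguments,
  hence it has to agree with the circuit with \<open>p + 1\<close> inputs of one family \<open>D\<close> of circuits
  without auxiliary memory gates. In particular, recurrent circuits of a family with equally
  many halting gates share their halting function.
\<close>

definition rec_class ::
  "(nat \<Rightarrow> circuit) set \<Rightarrow> (nat \<Rightarrow> circuit) set \<Rightarrow> (nat \<Rightarrow> real list \<Rightarrow> real list) set" where
  "rec_class Fh Fc = {f. \<exists>R.
     (\<forall>n. rec_circuit_wf (R n)) \<and> (\<lambda>n. body (R n)) \<in> Fc \<and>
     (\<exists>D \<in> Fh. (\<forall>k. auxs (D k) = []) \<and>
        (\<forall>n i v. i > 0 \<longrightarrow> length v = length (halt_gates (R n)) \<longrightarrow>
           circuit_fun (D (length v + 1)) (real i # v) [] = [of_bool (halt_fun (R n) i v)])) \<and>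
     (\<forall>n x. length x = n \<longrightarrow> rec_circuit_fun (R n) x = Some (f n x))}"

end

theory Submission
  imports Defs "HOL-Library.Countable"
begin

text \<open>
  One iteration of the composite circuit evaluates both given circuits side by side, together with
  the circuits deciding their halting conditions, which is why \<open>sign\<close> is needed in the body. A phase
  bit in memory is \<open>0\<close> until the first circuit has halted. While it is \<open>0\<close>, the memory gates of the
  second circuit are overwritten with the current outputs of the first one and with the initial
  auxiliary values; the overwriting done in the iteration in which the first circuit halts is thus
  the right start of the second computation. Once the bit is \<open>1\<close>, the second circuit follows its own
  recurrent edges. The composite halts when the phase bit times the halting bit of the second
  circuit is positive, so all composites share a single halting function.
\<close>

section \<open>Evaluation, depth and rank\<close>

text \<open>The first halting condition has to be decided inside the body because it controls memory
  updates, whereas a halting function can only stop the run. The second condition counts iterations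
  from the handover, so it needs a resettable counter of its own next to the one of the first
  circuit. Choosing between two values \<open>u\<close> and \<open>v\<close> by a bit
  \<open>b\<close> costs only additions and multiplications, \<open>(1 - b) * u + b * v\<close>;
  \<open>sign\<close> keeps the phase a bit and occurs otherwise only in the embedded circuits.
  Before the handover the copy of the second circuit computes with meaningless numbers, which is
  harmless: gates are total functions, and everything it contributes to an update or to halting is
  multiplied by the phase bit \<open>0\<close>. For the resource bounds, the second circuit is taken
  at index \<open>n' n\<close> and the halting circuits at the number of halting gates plus one, and
  these indices need not tend to infinity. They are counts of gates up to a constant, hence
  polynomially bounded, and the logarithm of a polynomial is again of order
  \<open>ln n\<close>.\<close>

definition label_op :: "gate_label \<Rightarrow> 'a set \<Rightarrow> real \<Rightarrow> ('a \<Rightarrow> real) \<Rightarrow> real" where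
  "label_op l S m v = (case l of
       Input \<Rightarrow> m
     | Aux \<Rightarrow> m
     | Const c \<Rightarrow> c
     | Plus \<Rightarrow> (\<Sum>h \<in> S. v h)
     | Times \<Rightarrow> (\<Prod>h \<in> S. v h)
     | Unary \<phi> \<Rightarrow> \<phi> (v (the_elem S))
     | Output \<Rightarrow> v (the_elem S))"

text \<open>Polymorphic in the gates, like \<open>label_op\<close>, so that numbered gates and named
  nodes share one set of rules. That output gates have no successors is left out: it concerns
  outgoing edges and not the set of predecessors.\<close>

definition arity_ok :: "(real \<Rightarrow> real) set \<Rightarrow> gate_label \<Rightarrow> 'a set \<Rightarrow> bool" where
  "arity_ok A l S = (case l of
       Input \<Rightarrow> S = {}
     | Aux \<Rightarrow> S = {}
     | Const c \<Rightarrow> S = {}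
     | Plus \<Rightarrow> True
     | Times \<Rightarrow> True
     | Unary \<phi> \<Rightarrow> \<phi> \<in> A \<and> card S = 1
     | Output \<Rightarrow> card S = 1)"

lemma gate_op_label_op: "gate_op C \<mu> v g = label_op (label C g) (preds C g) (\<mu> g) v"
  by (simp add: gate_op_def label_op_def split: gate_label.splits)

text \<open>The arity matters for the unary labels: \<open>the_elem\<close> of a set that is not a
  singleton need not lie in the set.\<close>

lemma label_op_cong:
  assumes "arity_ok A l S" and "\<And>h. h \<in> S \<Longrightarrow> v h = w h"
    and "l = Input \<or> l = Aux \<Longrightarrow> m = m'"
  shows "label_op l S m v = label_op l S m' w"
proof -
  have "v (the_elem S) = w (the_elem S)" if "card S = 1"
    using that assms(2) by (auto simp: card_1_singleton_iff)
  with assms show ?thesis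
    by (auto simp: label_op_def arity_ok_def split: gate_label.splits intro!: sum.cong prod.cong)
qed

lemma label_op_inner: "l \<notin> {Input, Aux} \<Longrightarrow> label_op l S m v = label_op l S m' v"
  by (auto simp: label_op_def split: gate_label.splits)

lemma arity_ok_image:
  assumes "arity_ok A l S" "inj e"
  shows "arity_ok A l (e ` S)"
  using assms by (auto simp: arity_ok_def card_image inj_on_subset split: gate_label.splits)

lemma label_op_image:
  assumes "arity_ok A l S" "inj e"
  shows "label_op l (e ` S) m v = label_op l S m (v \<circ> e)"
proof -
  have inj: "inj_on e S" using assms(2) by (rule inj_on_subset) simp
  have "the_elem (e ` S) = e (the_elem S)" if "card S = 1"
    using that by (auto simp: card_1_singleton_iff)
  with assms(1) inj show ?thesis
    by (auto simp: label_op_def arity_ok_def sum.reindex prod.reindex split: gate_label.splits)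
qed

lemma circuit_over_arity_ok:
  "circuit_over A C \<Longrightarrow> g \<in> gates C \<Longrightarrow> arity_ok A (label C g) (preds C g)"
  by (auto simp: circuit_over_def arity_ok_def split: gate_label.splits)

lemma preds_subset: "circuit_over A C \<Longrightarrow> preds C g \<subseteq> gates C"
  by (auto simp: circuit_over_def preds_def)

lemma circuit_over_mono:
  assumes "circuit_over A C" "A \<subseteq> B"
  shows "circuit_over B C"
proof -
  have "case label C g of Input \<Rightarrow> preds C g = {} | Aux \<Rightarrow> preds C g = {}
      | Const c \<Rightarrow> preds C g = {} | Plus \<Rightarrow> True | Times \<Rightarrow> True
      | Unary \<phi> \<Rightarrow> \<phi> \<in> B \<and> card (preds C g) = 1
      | Output \<Rightarrow> card (preds C g) = 1 \<and> (\<forall>h. (g, h) \<notin> edges C)" if "g \<in> gates C" for g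
    using assms that by (auto simp: circuit_over_def split: gate_label.splits)
  with assms show ?thesis by (auto simp: circuit_over_def)
qed

text \<open>On an acyclic graph the gate equations have a single solution. A copy inside a larger
  circuit can therefore be compared with the original just by checking these equations.\<close>

lemma gate_val_unique:
  assumes C: "circuit_over A C"
    and v: "\<And>g. g \<in> gates C \<Longrightarrow> v g = label_op (label C g) (preds C g) (\<mu> g) v"
    and g: "g \<in> gates C"
  shows "v g = gate_val C \<mu> g"
  using wf_edges[OF C] g
proof (induction g rule: wf_induct_rule)
  case (less g)
  have "v g = label_op (label C g) (preds C g) (\<mu> g) v"
    using v less.prems .
  also have "\<dots> = label_op (label C g) (preds C g) (\<mu> g) (gate_val C \<mu>)"
  proof (rule label_op_cong[OF circuit_over_arity_ok[OF C less.prems]])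
    fix h assume "h \<in> preds C g"
    then show "v h = gate_val C \<mu> h"
      using less.IH preds_subset[OF C, of g] by (auto simp: preds_def)
  qed simp
  also have "\<dots> = gate_val C \<mu> g"
    using gate_val_rec[OF C less.prems] by (simp add: gate_op_label_op)
  finally show ?case .
qed

lemma relpow_rank:
  fixes rk :: "'a \<Rightarrow> nat"
  assumes "\<And>h g. (h, g) \<in> E \<Longrightarrow> rk h < rk g" and "(a, b) \<in> E ^^ k"
  shows "rk a + k \<le> rk b"
  using assms(2)
proof (induction k arbitrary: b)
  case (Suc k)
  then obtain c where "(a, c) \<in> E ^^ k" "(c, b) \<in> E" by auto
  then show ?case using Suc.IH[of c] assms(1)[of c b] by fastforce
qed simp

text \<open>Every edge of a path climbs by at least one rank. Finiteness is recorded as well because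
  \<open>Max\<close> is meaningful only on finite sets.\<close>

lemma circuit_depth_le_rank:
  assumes "\<And>h g. (h, g) \<in> edges C \<Longrightarrow> rk h < rk g \<and> rk g \<le> (B::nat)"
  shows "circuit_depth C \<le> B" and "finite {k. edges C ^^ k \<noteq> {}}"
proof -
  have le: "k \<le> B" if ne: "edges C ^^ k \<noteq> {}" for k
  proof (cases k)
    case (Suc j)
    with ne obtain a b where ab: "(a, b) \<in> edges C ^^ k" by auto
    with Suc obtain c where "(c, b) \<in> edges C" by auto
    with relpow_rank[of "edges C" rk, OF _ ab] assms show ?thesis by fastforce
  qed simp
  then have "{k. edges C ^^ k \<noteq> {}} \<subseteq> {..B}" by blast
  then show fin: "finite {k. edges C ^^ k \<noteq> {}}"
    by (rule finite_subset) simp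
  \<comment> \<open>The zeroth power is the identity on all numbers, so the maximum is over a
    nonempty set even if there are no gates.\<close>
  have "(0, 0) \<in> edges C ^^ 0" by simp
  then have "{k. edges C ^^ k \<noteq> {}} \<noteq> {}" by blast
  with fin le show "circuit_depth C \<le> B" by (simp add: circuit_depth_def)
qed

lemma acyclic_rank:
  fixes rk :: "'a \<Rightarrow> nat"
  assumes "\<And>h g. (h, g) \<in> E \<Longrightarrow> rk h < rk g"
  shows "acyclic E"
  by (rule acyclic_subset[OF wf_acyclic[OF wf_measure[of rk]]]) (use assms in auto)

lemma circuit_paths_finite:
  assumes C: "circuit_over A C"
  shows "finite {k. edges C ^^ k \<noteq> {}}"
proof (rule circuit_depth_le_rank(2))
  \<comment> \<open>The number of proper ancestors is a rank: along an edge the source joins the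
    ancestors, and by acyclicity it was not among its own.\<close>
  let ?rk = "\<lambda>g. card {h. (h, g) \<in> (edges C)\<^sup>+}"
  have fin: "finite (gates C)" and sub: "edges C \<subseteq> gates C \<times> gates C"
    and ac: "acyclic (edges C)"
    using C by (auto simp: circuit_over_def)
  have anc: "{h. (h, g) \<in> (edges C)\<^sup>+} \<subseteq> gates C" for g
    using trancl_subset_Sigma[OF sub] by auto
  fix h g assume hg: "(h, g) \<in> edges C"
  have "{k. (k, h) \<in> (edges C)\<^sup>+} \<subset> {k. (k, g) \<in> (edges C)\<^sup>+}"
    using hg ac by (auto simp: acyclic_def intro: trancl_into_trancl)
  then show "?rk h < ?rk g \<and> ?rk g \<le> card (gates C)"
    using psubset_card_mono finite_subset[OF anc fin] card_mono[OF fin anc] by blast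
qed

text \<open>Height within one circuit; the ranks of the composite are obtained from it by adding
  offsets.\<close>

definition rank :: "circuit \<Rightarrow> nat \<Rightarrow> nat" where
  "rank C g = Max {k. \<exists>h. (h, g) \<in> edges C ^^ k}"

lemma
  assumes C: "circuit_over A C"
  shows rank_le_depth: "rank C g \<le> circuit_depth C"
    and rank_less: "h \<in> preds C g \<Longrightarrow> rank C h < rank C g"
proof -
  let ?P = "\<lambda>g. {k. \<exists>h. (h, g) \<in> edges C ^^ k}"
  have sub: "?P g \<subseteq> {k. edges C ^^ k \<noteq> {}}" for g by auto
  have fin: "finite (?P g)" for g
    using finite_subset[OF sub circuit_paths_finite[OF C]] .
  have "(g, g) \<in> edges C ^^ 0" for g by simp
  then have ne: "?P g \<noteq> {}" for g by blast
  show "rank C g \<le> circuit_depth C"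
    unfolding rank_def circuit_depth_def
    by (rule Max_mono[OF sub ne circuit_paths_finite[OF C]])
  assume h: "h \<in> preds C g"
  have "rank C h \<in> ?P h"
    unfolding rank_def using Max_in[OF fin ne] .
  then have "Suc (rank C h) \<in> ?P g"
    using h by (auto simp: preds_def)
  then have "Suc (rank C h) \<le> rank C g"
    unfolding rank_def by (rule Max_ge[OF fin])
  then show "rank C h < rank C g" by simp
qed

lemma
  assumes C: "circuit_over A C" and len: "length x = length (inputs C)" "length a = length (auxs C)"
  shows load_input: "j < length x \<Longrightarrow> load C x a (inputs C ! j) = x ! j"
    and load_aux: "j < length a \<Longrightarrow> load C x a (auxs C ! j) = a ! j"
proof -
  have d: "distinct (inputs C @ auxs C)"
    using C by (auto simp: circuit_over_def gates_labelled_def)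
  have *: "load C x a ((inputs C @ auxs C) ! k) = (x @ a) ! k" if "k < length (x @ a)" for k
    unfolding load_def using map_of_zip_nth[OF _ d that] len by simp
  show "j < length x \<Longrightarrow> load C x a (inputs C ! j) = x ! j"
    using *[of j] len by (simp add: nth_append)
  show "j < length a \<Longrightarrow> load C x a (auxs C ! j) = a ! j"
    using *[of "length x + j"] len by (simp add: nth_append)
qed

section \<open>Circuits on an arbitrary countable set of nodes\<close>

text \<open>Gates must be numbers, but numbering several embedded circuits by offsets is awkward. A
  countable datatype names the nodes instead, and \<open>to_nat\<close> turns the names into
  numbers.\<close>

definition encode_circuit ::
  "'a::countable set \<Rightarrow> ('a \<Rightarrow> gate_label) \<Rightarrow> ('a \<Rightarrow> 'a set) \<Rightarrow> 'a list \<Rightarrow> 'a list \<Rightarrow> 'a list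
    \<Rightarrow> circuit" where
  "encode_circuit N L P ins axs outs =
     \<lparr>gates = to_nat ` N, edges = {(to_nat h, to_nat g) | h g. g \<in> N \<and> h \<in> P g},
      label = L \<circ> from_nat, inputs = map to_nat ins, auxs = map to_nat axs,
      outputs = map to_nat outs\<rparr>"

lemma encode_circuit_simps [simp]:
  "gates (encode_circuit N L P ins axs outs) = to_nat ` N"
  "label (encode_circuit N L P ins axs outs) (to_nat g) = L g"
  "inputs (encode_circuit N L P ins axs outs) = map to_nat ins"
  "auxs (encode_circuit N L P ins axs outs) = map to_nat axs"
  "outputs (encode_circuit N L P ins axs outs) = map to_nat outs"
  by (simp_all add: encode_circuit_def)

lemma preds_encode_circuit:
  "g \<in> N \<Longrightarrow> preds (encode_circuit N L P ins axs outs) (to_nat g) = to_nat ` P g"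
  by (auto simp: preds_def encode_circuit_def)

text \<open>One rank function serves twice: its strict growth gives acyclicity, and its maximum
  bounds the depth.\<close>

lemma
  fixes rk :: "'a::countable \<Rightarrow> nat"
  assumes fin: "finite N"
    and ar: "\<And>g. g \<in> N \<Longrightarrow> arity_ok A (L g) (P g)"
    and sub: "\<And>g h. g \<in> N \<Longrightarrow> h \<in> P g \<Longrightarrow> h \<in> N \<and> L h \<noteq> Output"
    and rk: "\<And>g h. g \<in> N \<Longrightarrow> h \<in> P g \<Longrightarrow> rk h < rk g"
    and ins: "distinct ins" "\<And>g. g \<in> set ins \<longleftrightarrow> g \<in> N \<and> L g = Input"
    and axs: "distinct axs" "\<And>g. g \<in> set axs \<longleftrightarrow> g \<in> N \<and> L g = Aux"
    and outs: "distinct outs" "\<And>g. g \<in> set outs \<longleftrightarrow> g \<in> N \<and> L g = Output"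
  shows circuit_over_encode: "circuit_over A (encode_circuit N L P ins axs outs)"
    and depth_encode:
      "(\<And>g. g \<in> N \<Longrightarrow> rk g \<le> B) \<Longrightarrow> circuit_depth (encode_circuit N L P ins axs outs) \<le> B"
proof -
  let ?E = "encode_circuit N L P ins axs outs"
  have edge: "\<exists>h' g'. h = to_nat h' \<and> g = to_nat g' \<and> g' \<in> N \<and> h' \<in> P g'"
    if "(h, g) \<in> edges ?E" for h g
    using that by (auto simp: encode_circuit_def)
  have mem: "to_nat ` set gs = gates_labelled ?E l"
    if "\<And>g. g \<in> set gs \<longleftrightarrow> g \<in> N \<and> L g = l" for gs l
    using that by (auto simp: gates_labelled_def)
  have dist: "distinct (map to_nat gs)" if "distinct gs" for gs :: "'a list"
    using that by (simp add: distinct_map inj_on_def)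
  have lab: "case label ?E g of Input \<Rightarrow> preds ?E g = {} | Aux \<Rightarrow> preds ?E g = {}
      | Const c \<Rightarrow> preds ?E g = {} | Plus \<Rightarrow> True | Times \<Rightarrow> True
      | Unary \<phi> \<Rightarrow> \<phi> \<in> A \<and> card (preds ?E g) = 1
      | Output \<Rightarrow> card (preds ?E g) = 1 \<and> (\<forall>h. (g, h) \<notin> edges ?E)" if gE: "g \<in> gates ?E" for g
  proof -
    from gE obtain u where u: "g = to_nat u" "u \<in> N" by auto
    have a: "arity_ok A (label ?E g) (preds ?E g)"
      using arity_ok_image[OF ar[OF u(2)], of to_nat] u by (simp add: preds_encode_circuit)
    have "(g, h) \<notin> edges ?E" if "label ?E g = Output" for h
      using edge[of g h] sub that u by fastforce
    with a show ?thesis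
      by (auto simp: arity_ok_def split: gate_label.splits)
  qed
  have edge_rk: "(rk \<circ> from_nat) h < (rk \<circ> from_nat) g" if "(h, g) \<in> edges ?E" for h g
    using edge[OF that] rk by auto
  have ac: "acyclic (edges ?E)"
    by (rule acyclic_rank[OF edge_rk])
  have es: "edges ?E \<subseteq> gates ?E \<times> gates ?E"
    using sub by (auto simp: encode_circuit_def)
  show "circuit_over A ?E"
    unfolding circuit_over_def
  proof (intro conjI ballI)
    show "finite (gates ?E)" using fin by simp
    show "distinct (inputs ?E)" "distinct (auxs ?E)" "distinct (outputs ?E)"
      using dist ins(1) axs(1) outs(1) by simp_all
    show "set (inputs ?E) = gates_labelled ?E Input" "set (auxs ?E) = gates_labelled ?E Aux"
      "set (outputs ?E) = gates_labelled ?E Output"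
      using mem ins(2) axs(2) outs(2) by simp_all
  qed (rule es ac lab, assumption?)+
  show "circuit_depth ?E \<le> B" if "\<And>g. g \<in> N \<Longrightarrow> rk g \<le> B"
  proof (rule circuit_depth_le_rank(1)[of _ "rk \<circ> from_nat"])
    fix h g assume hg: "(h, g) \<in> edges ?E"
    then show "(rk \<circ> from_nat) h < (rk \<circ> from_nat) g \<and> (rk \<circ> from_nat) g \<le> B"
      using edge_rk[OF hg] edge[OF hg] that by auto
  qed
qed

lemma gate_val_encode:
  assumes E: "circuit_over A (encode_circuit N L P ins axs outs)" (is "circuit_over A ?E")
    and g: "g \<in> N" and ar: "arity_ok A (L g) (P g)"
  shows "gate_val ?E \<mu> (to_nat g)
    = label_op (L g) (P g) (\<mu> (to_nat g)) (gate_val ?E \<mu> \<circ> to_nat)"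
  using gate_val_rec[OF E, of "to_nat g" \<mu>] g label_op_image[OF ar, of to_nat]
  by (simp add: gate_op_label_op preds_encode_circuit)

lemma circuit_size_encode: "circuit_size (encode_circuit N L P ins axs outs) = card N"
  by (simp add: circuit_size_def card_image)

text \<open>Output gates must not have successors, so the output gates of embedded circuits are turned into
  sums with one summand.\<close>

definition demote :: "gate_label \<Rightarrow> gate_label" where
  "demote l = (if l = Output then Plus else l)"

lemma demote_neq_Output [simp]: "demote l \<noteq> Output"
  by (simp add: demote_def)

lemma arity_ok_demote: "arity_ok A l S \<Longrightarrow> arity_ok A (demote l) S"
  by (auto simp: arity_ok_def demote_def)

lemma label_op_demote: "arity_ok A l S \<Longrightarrow> label_op (demote l) S m v = label_op l S m v"
  by (auto simp: arity_ok_def demote_def label_op_def card_1_singleton_iff)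

text \<open>By uniqueness, since \<open>V \<circ> e\<close> solves the gate equations of
  \<open>C\<close>. The nodes standing for memory gates may be of any kind as long as they carry the
  values \<open>\<nu>\<close>; the argument \<open>0\<close> is a dummy, as only
  \<open>Input\<close> and \<open>Aux\<close> read it.\<close>

lemma gate_val_embedded:
  assumes C: "circuit_over A C" and e: "inj e"
    and inner: "\<And>g. g \<in> gates C \<Longrightarrow> label C g \<notin> {Input, Aux} \<Longrightarrow>
      V (e g) = label_op (demote (label C g)) (e ` preds C g) 0 V"
    and memory: "\<And>g. g \<in> gates C \<Longrightarrow> label C g \<in> {Input, Aux} \<Longrightarrow> V (e g) = \<nu> g"
    and g: "g \<in> gates C"
  shows "V (e g) = gate_val C \<nu> g"
proof -
  have "(V \<circ> e) g = label_op (label C g) (preds C g) (\<nu> g) (V \<circ> e)" if g: "g \<in> gates C" for g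
  proof (cases "label C g \<in> {Input, Aux}")
    case True
    then show ?thesis using memory[OF g] by (auto simp: label_op_def)
  next
    case False
    note ar = circuit_over_arity_ok[OF C g]
    have "V (e g) = label_op (label C g) (preds C g) 0 (V \<circ> e)"
      using inner[OF g False] label_op_demote[OF arity_ok_image[OF ar e]] label_op_image[OF ar e]
      by metis
    also have "\<dots> = label_op (label C g) (preds C g) (\<nu> g) (V \<circ> e)"
      by (rule label_op_cong[OF ar]) (use False in auto)
    finally show ?thesis by simp
  qed
  from gate_val_unique[OF C this g] show ?thesis by simp
qed

section \<open>The composite recurrent circuit\<close>

definition back_edge_source :: "rec_circuit \<Rightarrow> nat \<Rightarrow> nat" where
  "back_edge_source R g = (THE h. (h, g) \<in> rec_edges R)"

definition decides_halting :: "circuit \<Rightarrow> rec_circuit \<Rightarrow> bool" where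
  "decides_halting D R \<longleftrightarrow>
     auxs D = [] \<and> length (inputs D) = length (halt_gates R) + 1 \<and>
     (\<forall>i v. i > 0 \<longrightarrow> length v = length (halt_gates R) \<longrightarrow>
        circuit_fun D (real i # v) [] = [of_bool (halt_fun R i v)])"

lemma back_edge_source_eq: "rec_circuit_wf R \<Longrightarrow> g \<in> memory_gates (body R) \<Longrightarrow> (h, g) \<in> rec_edges R
    \<Longrightarrow> back_edge_source R g = h"
  unfolding back_edge_source_def rec_circuit_wf_def by (intro the1_equality) auto

lemma back_edge_source_gates:
  "rec_circuit_wf R \<Longrightarrow> g \<in> memory_gates (body R) \<Longrightarrow> back_edge_source R g \<in> gates (body R)"
  by (metis (no_types, lifting) SigmaD1 rec_circuit_wf_def back_edge_source_eq subsetD)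

lemma memory_gates_iff:
  "circuit_over A C \<Longrightarrow> g \<in> memory_gates C \<longleftrightarrow> g \<in> gates C \<and> label C g \<in> {Input, Aux}"
  by (auto simp: memory_gates_def circuit_over_def gates_labelled_def)

text \<open>Any admissible argument reveals the number of outputs; iteration \<open>1\<close> with
  all halting gates at \<open>0\<close> is one.\<close>

lemma decides_halting_outputs: "decides_halting D R \<Longrightarrow> outputs D = [hd (outputs D)]"
proof -
  assume "decides_halting D R"
  then have "circuit_fun D (real 1 # replicate (length (halt_gates R)) 0) []
      = [of_bool (halt_fun R 1 (replicate (length (halt_gates R)) 0))]"
    unfolding decides_halting_def by (metis length_replicate zero_less_one)
  then show ?thesis by (cases "outputs D") (auto simp: circuit_fun_def)
qed

text \<open>Inside the composite the inputs of \<open>D\<close> are computed nodes, not memory, so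
  their values enter as the assumption \<open>args\<close>.\<close>

lemma decision_value:
  assumes D: "circuit_over A D" and halt: "decides_halting D S" and h: "inj h"
    and inner: "\<And>g. g \<in> gates D \<Longrightarrow> label D g \<noteq> Input \<Longrightarrow>
      V (h g) = label_op (demote (label D g)) (h ` preds D g) 0 V"
    and args: "\<And>j. j < length (inputs D) \<Longrightarrow> V (h (inputs D ! j)) = (real i # w) ! j"
    and i: "i > 0" and w: "length w = length (halt_gates S)"
  shows "V (h (hd (outputs D))) = of_bool (halt_fun S i w)"
proof -
  let ?\<nu> = "load D (real i # w) []"
  note outs = decides_halting_outputs[OF halt]
  have val: "V (h g) = gate_val D ?\<nu> g" if "g \<in> gates D" for g
  proof (rule gate_val_embedded[OF D h _ _ that])
    fix g assume g: "g \<in> gates D" "label D g \<in> {Input, Aux}"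
    then have "g \<in> set (inputs D)"
      using D halt by (auto simp: circuit_over_def gates_labelled_def decides_halting_def)
    then obtain j where "j < length (inputs D)" "g = inputs D ! j"
      by (auto simp: in_set_conv_nth)
    then show "V (h g) = ?\<nu> g"
      using args load_input[OF D, of "real i # w" "[]" j] halt w by (simp add: decides_halting_def)
  qed (use inner in auto)
  have "hd (outputs D) \<in> gates D"
    using D list.set_intros(1)[of "hd (outputs D)" "[]", folded outs]
    by (auto simp: circuit_over_def gates_labelled_def)
  moreover have "[gate_val D ?\<nu> (hd (outputs D))] = [of_bool (halt_fun S i w)]"
    using halt i w outs unfolding decides_halting_def circuit_fun_def
    by (metis list.simps(8,9))
  ultimately show ?thesis using val by simp
qed

text \<open>\<open>M1\<close> and \<open>M2\<close> embed the two bodies, \<open>H1\<close> and \<open>H2\<close> the circuits deciding their halting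
  conditions. \<open>Upd g\<close> is the next value of the memory gate \<open>g\<close> of the second body: \<open>Src g\<close> is its
  start value, \<open>Load g = (1 - Phase) * Src g\<close>, and \<open>Keep g\<close> is \<open>Phase\<close> times its recurrent
  predecessor. \<open>Cnt2\<close> is reset in the same way, and \<open>NextPhase\<close> is the sign of
  \<open>Join = Phase + (halting bit of the first circuit)\<close>.\<close>

datatype node =
    M1 nat | H1 nat | M2 nat | H2 nat
  | Src nat | Load nat | Keep nat | Upd nat | Res nat
  | One | MinusOne | Phase | Neg | NPhase | Cnt1 | Inc1 | Cnt2 | KeepCnt | Inc2
  | Join | NextPhase | Halt

instance node :: countable
  by countable_datatype

text \<open>Everything for one fixed input length; the dependence on the length matters only for the
  asymptotic bounds.\<close>

locale composition =
  fixes A :: "(real \<Rightarrow> real) set" and R R' :: rec_circuit and D D' :: circuit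
  assumes sign: "sign_fn \<in> A"
    and C: "circuit_over A (body R)" and C': "circuit_over A (body R')"
    and D: "circuit_over A D" and D': "circuit_over A D'"
    and wf: "rec_circuit_wf R" and wf': "rec_circuit_wf R'"
    and halt: "decides_halting D R" and halt': "decides_halting D' R'"
    and dims: "length (outputs (body R)) = length (inputs (body R'))"
begin

definition source :: "circuit \<Rightarrow> node \<Rightarrow> (nat \<Rightarrow> node) \<Rightarrow> rec_circuit \<Rightarrow> nat \<Rightarrow> node" where
  "source B c e S g = the (map_of (zip (inputs B) (c # map e (halt_gates S))) g)"

definition nodes :: "node set" where
  "nodes = M1 ` gates (body R) \<union> H1 ` gates D \<union> M2 ` gates (body R') \<union> H2 ` gates D' \<union>
     Src ` memory_gates (body R') \<union> Load ` memory_gates (body R') \<union>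
     Keep ` memory_gates (body R') \<union> Upd ` memory_gates (body R') \<union>
     Res ` set (outputs (body R')) \<union>
     {One, MinusOne, Phase, Neg, NPhase, Cnt1, Inc1, Cnt2, KeepCnt, Inc2, Join, NextPhase, Halt}"

text \<open>Only the inputs of the first body stay inputs. Those of the second become auxiliary
  memory, and those of the halting circuits become one-summand sums forwarding a value of the same
  iteration.\<close>

fun node_label :: "node \<Rightarrow> gate_label" where
  "node_label (M1 g) = demote (label (body R) g)"
| "node_label (H1 g) = (if label D g = Input then Plus else demote (label D g))"
| "node_label (M2 g) = (if label (body R') g = Input then Aux else demote (label (body R') g))"
| "node_label (H2 g) = (if label D' g = Input then Plus else demote (label D' g))"
| "node_label (Src g) = (if g \<in> set (inputs (body R')) then Plus
     else Const (the (map_of (zip (auxs (body R')) (init_aux R')) g)))"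
| "node_label (Load g) = Times"
| "node_label (Keep g) = Times"
| "node_label (Upd g) = Plus"
| "node_label (Res g) = Output"
| "node_label One = Const 1"
| "node_label MinusOne = Const (-1)"
| "node_label Phase = Aux"
| "node_label Neg = Times"
| "node_label NPhase = Plus"
| "node_label Cnt1 = Aux"
| "node_label Inc1 = Plus"
| "node_label Cnt2 = Aux"
| "node_label KeepCnt = Times"
| "node_label Inc2 = Plus"
| "node_label Join = Plus"
| "node_label NextPhase = Unary sign_fn"
| "node_label Halt = Times"

text \<open>Predecessors form a set, so a sum or product of two values needs two distinct nodes;
  here their constructors always differ. Subtraction is done by multiplying with
  \<open>MinusOne\<close>.\<close>

fun node_preds :: "node \<Rightarrow> node set" where
  "node_preds (M1 g) = M1 ` preds (body R) g"
| "node_preds (H1 g) = (if label D g = Input then {source D Cnt1 M1 R g} else H1 ` preds D g)"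
| "node_preds (M2 g) = M2 ` preds (body R') g"
| "node_preds (H2 g) = (if label D' g = Input then {source D' Cnt2 M2 R' g} else H2 ` preds D' g)"
| "node_preds (Src g) = (if g \<in> set (inputs (body R'))
     then {M1 (the (map_of (zip (inputs (body R')) (outputs (body R))) g))} else {})"
| "node_preds (Load g) = {NPhase, Src g}"
| "node_preds (Keep g) = {Phase, M2 (back_edge_source R' g)}"
| "node_preds (Upd g) = {Load g, Keep g}"
| "node_preds (Res g) = {M2 g}"
| "node_preds One = {}"
| "node_preds MinusOne = {}"
| "node_preds Phase = {}"
| "node_preds Neg = {MinusOne, Phase}"
| "node_preds NPhase = {One, Neg}"
| "node_preds Cnt1 = {}"
| "node_preds Inc1 = {One, Cnt1}"
| "node_preds Cnt2 = {}"
| "node_preds KeepCnt = {Phase, Cnt2}"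
| "node_preds Inc2 = {One, KeepCnt}"
| "node_preds Join = {Phase, H1 (hd (outputs D))}"
| "node_preds NextPhase = {Join}"
| "node_preds Halt = {Phase, H2 (hd (outputs D'))}"

abbreviation "d1 \<equiv> circuit_depth (body R)"
abbreviation "d2 \<equiv> circuit_depth (body R')"
abbreviation "e1 \<equiv> circuit_depth D"
abbreviation "e2 \<equiv> circuit_depth D'"

text \<open>A halting circuit may read halting gates of any height, so its copy starts above the
  whole body, at offset \<open>d1 + 1\<close> or \<open>d2 + 1\<close>. \<open>Load\<close> has to
  lie above both \<open>Src\<close> at \<open>d1 + 1\<close> and \<open>NPhase\<close> at
  \<open>2\<close>, and \<open>Upd\<close> above both \<open>Load\<close> and
  \<open>Keep\<close>.\<close>

fun node_rank :: "node \<Rightarrow> nat" where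
  "node_rank (M1 g) = rank (body R) g"
| "node_rank (H1 g) = d1 + 1 + rank D g"
| "node_rank (M2 g) = rank (body R') g"
| "node_rank (H2 g) = d2 + 1 + rank D' g"
| "node_rank (Src g) = d1 + 1"
| "node_rank (Load g) = d1 + 3"
| "node_rank (Keep g) = d2 + 1"
| "node_rank (Upd g) = d1 + d2 + 4"
| "node_rank (Res g) = d2 + 1"
| "node_rank One = 0"
| "node_rank MinusOne = 0"
| "node_rank Phase = 0"
| "node_rank Neg = 1"
| "node_rank NPhase = 2"
| "node_rank Cnt1 = 0"
| "node_rank Inc1 = 1"
| "node_rank Cnt2 = 0"
| "node_rank KeepCnt = 1"
| "node_rank Inc2 = 2"
| "node_rank Join = d1 + e1 + 2"
| "node_rank NextPhase = d1 + e1 + 3"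
| "node_rank Halt = d2 + e2 + 2"

definition ins :: "node list" where
  "ins = map M1 (inputs (body R))"

definition axs :: "node list" where
  "axs = map M1 (auxs (body R)) @ map M2 (inputs (body R') @ auxs (body R')) @ [Cnt1, Cnt2, Phase]"

definition composite_body :: circuit where
  "composite_body = encode_circuit nodes node_label node_preds ins axs (map Res (outputs (body R')))"

text \<open>The source of the recurrent edge into a memory node; the last equation serves only \<open>Phase\<close>.\<close>

fun update :: "node \<Rightarrow> node" where
  "update (M1 g) = M1 (back_edge_source R g)"
| "update (M2 g) = Upd g"
| "update Cnt1 = Inc1"
| "update Cnt2 = Inc2"
| "update u = NextPhase"

text \<open>\<open>Cnt1\<close> starts at \<open>1\<close> because iterations are numbered from
  \<open>1\<close>. The zeros for the second copy and for \<open>Cnt2\<close> are arbitrary, being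
  overwritten while the phase is \<open>0\<close>.\<close>

definition composite :: rec_circuit where
  "composite = \<lparr>body = composite_body,
     init_aux = init_aux R @ replicate (length (inputs (body R') @ auxs (body R'))) 0 @ [1, 0, 0],
     rec_edges = (\<lambda>u. (to_nat (update u), to_nat u)) ` set (ins @ axs),
     halt_fun = (\<lambda>i v. sum_list v > 0),
     halt_gates = [to_nat Halt]\<rparr>"

section \<open>Well-formedness and depth of the composite\<close>

lemma source_nth:
  assumes "circuit_over A B" "decides_halting B S" "j < length (inputs B)"
  shows "source B c e S (inputs B ! j) = (c # map e (halt_gates S)) ! j"
proof -
  have "map_of (zip (inputs B) (c # map e (halt_gates S))) (inputs B ! j)
      = Some ((c # map e (halt_gates S)) ! j)"
    using assms by (intro map_of_zip_nth) (auto simp: decides_halting_def circuit_over_def)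
  then show ?thesis by (simp add: source_def)
qed

lemma source_in:
  assumes "circuit_over A B" "decides_halting B S" "g \<in> gates B" "label B g = Input"
  shows "source B c e S g \<in> insert c (e ` set (halt_gates S))"
proof -
  have "g \<in> set (inputs B)"
    using assms by (auto simp: circuit_over_def gates_labelled_def)
  then obtain j where j: "j < length (inputs B)" "g = inputs B ! j"
    by (auto simp: in_set_conv_nth)
  then have "(c # map e (halt_gates S)) ! j \<in> set (c # map e (halt_gates S))"
    using assms(2) by (intro nth_mem) (simp add: decides_halting_def)
  then show ?thesis using source_nth[OF assms(1,2) j(1)] j(2) by simp
qed

lemma handover:
  assumes "j < length (outputs (body R))"
  shows "the (map_of (zip (inputs (body R')) (outputs (body R))) (inputs (body R') ! j))
    = outputs (body R) ! j"
  using map_of_zip_nth[of "inputs (body R')" "outputs (body R)" j] assms dims C'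
  by (simp add: circuit_over_def)

lemma handover_in:
  assumes "g \<in> set (inputs (body R'))"
  shows "the (map_of (zip (inputs (body R')) (outputs (body R))) g) \<in> gates (body R)"
proof -
  from assms obtain j where j: "j < length (outputs (body R))" "g = inputs (body R') ! j"
    using dims by (auto simp: in_set_conv_nth)
  then have "outputs (body R) ! j \<in> set (outputs (body R))" by simp
  with handover[OF j(1)] j(2) C show ?thesis
    by (auto simp: circuit_over_def gates_labelled_def)
qed

lemma hd_outputs_in: "circuit_over A B \<Longrightarrow> decides_halting B S \<Longrightarrow> hd (outputs B) \<in> gates B"
  using decides_halting_outputs[of B S]
  by (auto simp: circuit_over_def gates_labelled_def)
    (metis (mono_tags, lifting) list.set_intros(1) mem_Collect_eq)

lemma finite_nodes: "finite nodes"
proof -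
  have "finite (gates (body R))" "finite (gates (body R'))" "finite (gates D)" "finite (gates D')"
    using C C' D D' by (simp_all add: circuit_over_def)
  then show ?thesis by (simp add: nodes_def memory_gates_def)
qed

lemma node_arity: "u \<in> nodes \<Longrightarrow> arity_ok A (node_label u) (node_preds u)"
proof (cases u)
  case (M1 g)
  assume "u \<in> nodes"
  with M1 show ?thesis
    using arity_ok_demote[OF arity_ok_image[OF circuit_over_arity_ok[OF C], of g node.M1]]
    by (auto simp: nodes_def inj_def)
next
  case (M2 g)
  assume "u \<in> nodes"
  with M2 have g: "g \<in> gates (body R')" by (auto simp: nodes_def)
  from arity_ok_demote[OF arity_ok_image[OF circuit_over_arity_ok[OF C' g], of node.M2]]
  have "arity_ok A (demote (label (body R') g)) (node.M2 ` preds (body R') g)"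
    by (simp add: inj_def)
  with M2 show ?thesis by (auto simp: arity_ok_def demote_def)
next
  case (H1 g)
  assume "u \<in> nodes"
  with H1 show ?thesis
    using arity_ok_demote[OF arity_ok_image[OF circuit_over_arity_ok[OF D], of g node.H1]]
    by (auto simp: nodes_def inj_def) (simp add: arity_ok_def)
next
  case (H2 g)
  assume "u \<in> nodes"
  with H2 show ?thesis
    using arity_ok_demote[OF arity_ok_image[OF circuit_over_arity_ok[OF D'], of g node.H2]]
    by (auto simp: nodes_def inj_def) (simp add: arity_ok_def)
qed (auto simp: arity_ok_def sign)

lemma node_label_eq_Output: "node_label u = Output \<longleftrightarrow> (\<exists>g. u = Res g)"
  by (cases u) (auto simp: demote_def)

lemma halt_gates_in: "rec_circuit_wf S \<Longrightarrow> set (halt_gates S) \<subseteq> gates (body S)"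
  by (simp add: rec_circuit_wf_def)

lemma source_range:
  assumes "circuit_over A B" "decides_halting B S" "rec_circuit_wf S"
    and "g \<in> gates B" "label B g = Input"
  shows "source B c e S g \<in> insert c (e ` gates (body S))"
  using source_in[OF assms(1,2,4,5)] halt_gates_in[OF assms(3)] by blast

lemma nodes_simps [simp]:
  "M1 g \<in> nodes \<longleftrightarrow> g \<in> gates (body R)" "H1 g \<in> nodes \<longleftrightarrow> g \<in> gates D"
  "M2 g \<in> nodes \<longleftrightarrow> g \<in> gates (body R')" "H2 g \<in> nodes \<longleftrightarrow> g \<in> gates D'"
  "Src g \<in> nodes \<longleftrightarrow> g \<in> memory_gates (body R')" "Load g \<in> nodes \<longleftrightarrow> g \<in> memory_gates (body R')"
  "Keep g \<in> nodes \<longleftrightarrow> g \<in> memory_gates (body R')" "Upd g \<in> nodes \<longleftrightarrow> g \<in> memory_gates (body R')"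
  "Res g \<in> nodes \<longleftrightarrow> g \<in> set (outputs (body R'))"
  "One \<in> nodes" "MinusOne \<in> nodes" "Phase \<in> nodes" "Neg \<in> nodes" "NPhase \<in> nodes"
  "Cnt1 \<in> nodes" "Inc1 \<in> nodes" "Cnt2 \<in> nodes" "KeepCnt \<in> nodes" "Inc2 \<in> nodes"
  "Join \<in> nodes" "NextPhase \<in> nodes" "Halt \<in> nodes"
  by (auto simp: nodes_def)

lemma node_preds_in:
  assumes "u \<in> nodes" "w \<in> node_preds u"
  shows "w \<in> nodes \<and> node_label w \<noteq> Output"
proof -
  have outs: "g \<in> gates (body R')" if "g \<in> set (outputs (body R'))" for g
    using C' that by (auto simp: circuit_over_def gates_labelled_def)
  note sub = subsetD[OF preds_subset[OF C]] subsetD[OF preds_subset[OF C']]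
    subsetD[OF preds_subset[OF D]] subsetD[OF preds_subset[OF D']]
  show ?thesis
  proof (cases u)
    case (H1 g)
    with assms source_range[OF D halt wf, of g Cnt1 M1] sub show ?thesis
      by (auto simp: node_label_eq_Output split: if_splits)
  next
    case (H2 g)
    with assms source_range[OF D' halt' wf', of g Cnt2 M2] sub show ?thesis
      by (auto simp: node_label_eq_Output split: if_splits)
  next
    case (Src g)
    with assms handover_in show ?thesis
      by (auto simp: node_label_eq_Output split: if_splits)
  qed (use assms in \<open>auto simp: node_label_eq_Output sub outs back_edge_source_gates[OF wf']
      hd_outputs_in[OF D halt] hd_outputs_in[OF D' halt']\<close>)
qed

lemma node_rank_less:
  assumes "u \<in> nodes" "w \<in> node_preds u"
  shows "node_rank w < node_rank u"
proof -
  note le = rank_le_depth[OF C] rank_le_depth[OF C'] rank_le_depth[OF D] rank_le_depth[OF D']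
  note less = rank_less[OF C] rank_less[OF C'] rank_less[OF D] rank_less[OF D']
  show ?thesis
  proof (cases u)
    case (H1 g)
    show ?thesis
    proof (cases "label D g = Input")
      case True
      with H1 assms source_range[OF D halt wf, of g Cnt1 M1] le(1) show ?thesis
        by (auto simp: less_Suc_eq_le intro: trans_le_add1)
    next
      case False
      with H1 assms less(3) show ?thesis by auto
    qed
  next
    case (H2 g)
    show ?thesis
    proof (cases "label D' g = Input")
      case True
      with H2 assms source_range[OF D' halt' wf', of g Cnt2 M2] le(2) show ?thesis
        by (auto simp: less_Suc_eq_le intro: trans_le_add1)
    next
      case False
      with H2 assms less(4) show ?thesis by auto
    qed
  next
    case (Src g)
    with assms le(1) show ?thesis by (auto simp: less_Suc_eq_le split: if_splits)
  next
    case Join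
    with assms le(3)[of "hd (outputs D)"] show ?thesis by auto
  next
    case Halt
    with assms le(4)[of "hd (outputs D')"] show ?thesis by auto
  qed (use assms less in \<open>auto simp: less_Suc_eq_le le\<close>)
qed

lemma node_rank_le: "u \<in> nodes \<Longrightarrow> node_rank u \<le> d1 + d2 + e1 + e2 + 4"
proof -
  have le: "rank (body R) g \<le> d1" "rank (body R') g \<le> d2" "rank D g \<le> e1" "rank D' g \<le> e2" for g
    using rank_le_depth C C' D D' by blast+
  show ?thesis
  proof (cases u)
    case (M1 g) with le(1)[of g] show ?thesis by simp
  next
    case (M2 g) with le(2)[of g] show ?thesis by simp
  next
    case (H1 g) with le(3)[of g] show ?thesis by simp
  next
    case (H2 g) with le(4)[of g] show ?thesis by simp
  qed simp_all
qed

lemma ins_axs: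
  shows "distinct ins" and "u \<in> set ins \<longleftrightarrow> u \<in> nodes \<and> node_label u = Input"
    and "distinct axs" and "u \<in> set axs \<longleftrightarrow> u \<in> nodes \<and> node_label u = Aux"
    and "distinct (map Res (outputs (body R')))"
    and "u \<in> set (map Res (outputs (body R'))) \<longleftrightarrow> u \<in> nodes \<and> node_label u = Output"
proof -
  note defs = circuit_over_def gates_labelled_def
  show "distinct ins" "distinct axs" "distinct (map Res (outputs (body R')))"
    using C C' by (auto simp: ins_def axs_def distinct_map inj_on_def defs)
  have in1: "set (inputs (body R)) = {g \<in> gates (body R). label (body R) g = Input}"
    and ax1: "set (auxs (body R)) = {g \<in> gates (body R). label (body R) g = Aux}"
    and in2: "set (inputs (body R')) = {g \<in> gates (body R'). label (body R') g = Input}"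
    and ax2: "set (auxs (body R')) = {g \<in> gates (body R'). label (body R') g = Aux}"
    using C C' by (auto simp: defs)
  \<comment> \<open>Copies of halting circuits keep the label \<open>Aux\<close>, so such a gate
    would be memory missing from \<open>axs\<close>.\<close>
  have noaux: "label B g \<noteq> Aux" if "circuit_over A B" "decides_halting B S" "g \<in> gates B" for B S g
    using that by (auto simp: defs decides_halting_def)
  show "u \<in> set ins \<longleftrightarrow> u \<in> nodes \<and> node_label u = Input"
    by (cases u) (auto simp: ins_def nodes_def in1 demote_def)
  show "u \<in> set axs \<longleftrightarrow> u \<in> nodes \<and> node_label u = Aux"
    by (cases u)
      (auto simp: axs_def nodes_def in2 ax1 ax2 demote_def noaux[OF D halt] noaux[OF D' halt']
        split: if_splits)
  show "u \<in> set (map Res (outputs (body R'))) \<longleftrightarrow> u \<in> nodes \<and> node_label u = Output"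
    by (auto simp: node_label_eq_Output nodes_def)
qed

lemmas encode_facts = finite_nodes node_arity node_preds_in node_rank_less ins_axs

lemma composite_over: "circuit_over A composite_body"
  unfolding composite_body_def by (rule circuit_over_encode) (rule encode_facts; assumption)+

lemma composite_depth: "circuit_depth composite_body \<le> d1 + d2 + e1 + e2 + 4"
  unfolding composite_body_def
  by (rule depth_encode[where rk = node_rank]) (rule encode_facts node_rank_le; assumption)+

lemma update_in:
  assumes "u \<in> set (ins @ axs)"
  shows "update u \<in> nodes"
proof -
  have "M1 g \<in> set (ins @ axs) \<Longrightarrow> g \<in> memory_gates (body R)"
    and "M2 g \<in> set (ins @ axs) \<Longrightarrow> g \<in> memory_gates (body R')" for g
    by (auto simp: ins_def axs_def memory_gates_def)
  then show ?thesis
    using assms back_edge_source_gates[OF wf] by (induction u) auto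
qed

lemma memory_in:
  "g \<in> memory_gates (body R) \<Longrightarrow> M1 g \<in> set (ins @ axs)"
  "g \<in> memory_gates (body R') \<Longrightarrow> M2 g \<in> set (ins @ axs)"
  "Cnt1 \<in> set (ins @ axs)" "Cnt2 \<in> set (ins @ axs)" "Phase \<in> set (ins @ axs)"
  by (auto simp: ins_def axs_def memory_gates_def)

lemma composite_simps [simp]:
  "body composite = composite_body" "halt_gates composite = [to_nat Halt]"
  "halt_fun composite = (\<lambda>i v. sum_list v > 0)"
  by (simp_all add: composite_def)

lemma composite_body_simps [simp]:
  "inputs composite_body = map to_nat ins" "auxs composite_body = map to_nat axs"
  "outputs composite_body = map to_nat (map Res (outputs (body R')))"
  "gates composite_body = to_nat ` nodes"
  by (simp_all add: composite_body_def)

lemma length_init: "length (init_aux composite) = length axs"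
  using wf by (simp add: composite_def axs_def rec_circuit_wf_def)

lemma rec_edges_composite:
  "(h, to_nat u) \<in> rec_edges composite \<longleftrightarrow> u \<in> set (ins @ axs) \<and> h = to_nat (update u)"
  by (auto simp: composite_def)

lemma composite_wf: "rec_circuit_wf composite"
  unfolding rec_circuit_wf_def
proof (intro conjI ballI)
  show "length (init_aux composite) = length (auxs (body composite))"
    by (simp add: length_init)
  show "rec_edges composite \<subseteq> gates (body composite) \<times> memory_gates (body composite)"
    using update_in by (auto simp: composite_def memory_gates_def)
  fix g assume "g \<in> memory_gates (body composite)"
  then obtain u where "g = to_nat u" "u \<in> set (ins @ axs)"
    by (auto simp: memory_gates_def)
  then show "\<exists>!h. (h, g) \<in> rec_edges composite"
    by (simp add: rec_edges_composite)
qed auto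

section \<open>Node values in a run of the composite\<close>

definition val :: "real list \<Rightarrow> nat \<Rightarrow> node \<Rightarrow> real" where
  "val x t u = gate_val composite_body (memory composite x t) (to_nat u)"

lemma val_node:
  "u \<in> nodes \<Longrightarrow>
    val x t u = label_op (node_label u) (node_preds u) (memory composite x t (to_nat u)) (val x t)"
  unfolding val_def composite_body_def
  by (subst gate_val_encode[OF composite_over[unfolded composite_body_def]])
    (auto simp: node_arity comp_def)

lemma val_memory: "u \<in> set (ins @ axs) \<Longrightarrow> val x t u = memory composite x t (to_nat u)"
  using val_node[of u x t] ins_axs(2,4)[of u] by (auto simp: label_op_def)

lemma val_Suc: "u \<in> set (ins @ axs) \<Longrightarrow> val x (Suc t) u = val x t (update u)"
  by (subst val_memory) (simp_all add: rec_edges_composite val_def)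

lemmas val_step = memory_in[THEN val_Suc, unfolded update.simps]

lemma val_ins: "length x = length ins \<Longrightarrow> j < length ins \<Longrightarrow> val x 0 (ins ! j) = x ! j"
  using load_input[OF composite_over, of x "init_aux composite" j]
  by (simp add: val_memory length_init)

lemma val_axs:
  "length x = length ins \<Longrightarrow> j < length axs \<Longrightarrow> val x 0 (axs ! j) = init_aux composite ! j"
  using load_aux[OF composite_over, of x "init_aux composite" j]
  by (simp add: val_memory length_init)

lemma val_inner:
  assumes "u \<in> nodes" "node_label u \<notin> {Input, Aux}"
  shows "val x t u = label_op (node_label u) (node_preds u) 0 (val x t)"
  using val_node[OF assms(1)] label_op_inner[OF assms(2)] by metis

lemma val_scalars:
  "val x t One = 1"
  "val x t NPhase = 1 - val x t Phase"
  "val x t Inc1 = 1 + val x t Cnt1"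
  "val x t Inc2 = 1 + val x t Phase * val x t Cnt2"
  "val x t NextPhase = sign_fn (val x t Phase + val x t (H1 (hd (outputs D))))"
  "val x t Halt = val x t Phase * val x t (H2 (hd (outputs D')))"
  by (simp_all add: val_inner label_op_def)

text \<open>A multiplexer: for a phase of \<open>0\<close> or \<open>1\<close> exactly one of the
  two candidate values survives.\<close>

lemma val_Load:
  assumes "g \<in> memory_gates (body R')"
  shows "val x t (Upd g) = (1 - val x t Phase) * val x t (Src g)
    + val x t Phase * val x t (M2 (back_edge_source R' g))"
  using assms by (simp add: val_inner[of "Upd g"] val_inner[of "Load g"] val_inner[of "Keep g"]
      label_op_def val_scalars)

lemma val_M1_gate_val:
  assumes g: "g \<in> gates (body R)"
    and mem: "\<And>g. g \<in> memory_gates (body R) \<Longrightarrow> val x t (M1 g) = \<mu> g"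
  shows "val x t (M1 g) = gate_val (body R) \<mu> g"
proof (rule gate_val_embedded[where V = "val x t" and e = M1, OF C _ _ _ g])
  show "inj M1" by (simp add: inj_def)
  show "val x t (M1 g) = label_op (demote (label (body R) g)) (M1 ` preds (body R) g) 0 (val x t)"
    if "g \<in> gates (body R)" "label (body R) g \<notin> {Input, Aux}" for g
    using val_inner[of "M1 g"] that by (simp add: demote_def)
qed (use mem memory_gates_iff[OF C] in auto)

lemma val_M2_gate_val:
  assumes g: "g \<in> gates (body R')"
    and mem: "\<And>g. g \<in> memory_gates (body R') \<Longrightarrow> val x t (M2 g) = \<mu> g"
  shows "val x t (M2 g) = gate_val (body R') \<mu> g"
proof (rule gate_val_embedded[where V = "val x t" and e = M2, OF C' _ _ _ g])
  show "inj M2" by (simp add: inj_def)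
  show "val x t (M2 g) = label_op (demote (label (body R') g)) (M2 ` preds (body R') g) 0 (val x t)"
    if "g \<in> gates (body R')" "label (body R') g \<notin> {Input, Aux}" for g
    using val_inner[of "M2 g"] that by (simp add: demote_def)
qed (use mem memory_gates_iff[OF C'] in auto)

lemma val_source:
  assumes "circuit_over A B" "decides_halting B S" "j < length (inputs B)"
    and "val x t c = real i"
  shows "val x t (source B c e S (inputs B ! j)) = (real i # map (val x t \<circ> e) (halt_gates S)) ! j"
  using assms(2,3,4) source_nth[OF assms(1-3)]
  by (cases j) (simp_all add: decides_halting_def)

text \<open>The copied inputs forward the counter and the halting gates of the same iteration, so
  the decision is available without delay.\<close>

lemma val_H1:
  assumes "val x t Cnt1 = real i" "i > 0"
  shows "val x t (H1 (hd (outputs D))) = of_bool (halt_fun R i (map (val x t \<circ> M1) (halt_gates R)))"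
proof (rule decision_value[where V = "val x t" and h = H1, OF D halt])
  show "inj H1" by (simp add: inj_def)
  show "val x t (H1 g) = label_op (demote (label D g)) (H1 ` preds D g) 0 (val x t)"
    if "g \<in> gates D" "label D g \<noteq> Input" for g
  proof -
    from that D halt have "label D g \<noteq> Aux"
      by (auto simp: circuit_over_def gates_labelled_def decides_halting_def)
    with that show ?thesis using val_inner[of "H1 g"] by (simp add: demote_def)
  qed
  show "val x t (H1 (inputs D ! j)) = (real i # map (val x t \<circ> M1) (halt_gates R)) ! j"
    if j: "j < length (inputs D)" for j
  proof -
    have "inputs D ! j \<in> gates D" "label D (inputs D ! j) = Input"
      using nth_mem[OF j] D by (auto simp: circuit_over_def gates_labelled_def)
    then show ?thesis
      using val_source[OF D halt j assms(1)] val_inner[of "H1 (inputs D ! j)"]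
      by (simp add: label_op_def)
  qed
qed (use assms in auto)

lemma val_H2:
  assumes "val x t Cnt2 = real i" "i > 0"
  shows "val x t (H2 (hd (outputs D'))) = of_bool (halt_fun R' i (map (val x t \<circ> M2) (halt_gates R')))"
proof (rule decision_value[where V = "val x t" and h = H2, OF D' halt'])
  show "inj H2" by (simp add: inj_def)
  show "val x t (H2 g) = label_op (demote (label D' g)) (H2 ` preds D' g) 0 (val x t)"
    if "g \<in> gates D'" "label D' g \<noteq> Input" for g
  proof -
    from that D' halt' have "label D' g \<noteq> Aux"
      by (auto simp: circuit_over_def gates_labelled_def decides_halting_def)
    with that show ?thesis using val_inner[of "H2 g"] by (simp add: demote_def)
  qed
  show "val x t (H2 (inputs D' ! j)) = (real i # map (val x t \<circ> M2) (halt_gates R')) ! j"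
    if j: "j < length (inputs D')" for j
  proof -
    have "inputs D' ! j \<in> gates D'" "label D' (inputs D' ! j) = Input"
      using nth_mem[OF j] D' by (auto simp: circuit_over_def gates_labelled_def)
    then show ?thesis
      using val_source[OF D' halt' j assms(1)] val_inner[of "H2 (inputs D' ! j)"]
      by (simp add: label_op_def)
  qed
qed (use assms in auto)

section \<open>The first circuit and the phase bit\<close>

context
  fixes x :: "real list"
  assumes x: "length x = length (inputs (body R))"
begin

lemma x_ins: "length x = length ins"
  by (simp add: x ins_def)

text \<open>Time \<open>t\<close> counts memory updates and thus belongs to iteration
  \<open>t + 1\<close>.\<close>

lemma val_Cnt1: "val x t Cnt1 = real (Suc t)"
proof (induction t)
  case 0
  let ?j = "length (auxs (body R)) + length (inputs (body R') @ auxs (body R'))"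
  have "axs ! ?j = Cnt1" "init_aux composite ! ?j = 1" "?j < length axs"
    using wf by (simp_all add: axs_def composite_def rec_circuit_wf_def nth_append)
  with val_axs[OF x_ins, of ?j] show ?case by simp
next
  case (Suc t)
  then show ?case by (simp add: val_step val_scalars)
qed

lemma val_Phase_0: "val x 0 Phase = 0"
proof -
  \<comment> \<open>In \<open>axs\<close>, the two counters come between the memory of the second
    body and \<open>Phase\<close>, hence the \<open>2\<close>.\<close>
  let ?j = "length (auxs (body R)) + length (inputs (body R') @ auxs (body R')) + 2"
  have "axs ! ?j = Phase" "init_aux composite ! ?j = 0" "?j < length axs"
    using wf by (simp_all add: axs_def composite_def rec_circuit_wf_def nth_append)
  with val_axs[OF x_ins, of ?j] show ?thesis by simp
qed

text \<open>The first copy reads nothing from the rest of the composite, so the simulation stays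
  exact even after its halting iteration.\<close>

lemma val_M1: "g \<in> gates (body R) \<Longrightarrow> val x t (M1 g) = gate_val (body R) (memory R x t) g"
proof (induction t arbitrary: g)
  case 0
  show ?case
  proof (rule val_M1_gate_val[OF 0])
    fix g assume "g \<in> memory_gates (body R)"
    then consider j where "j < length (inputs (body R))" "g = inputs (body R) ! j"
      | j where "j < length (auxs (body R))" "g = auxs (body R) ! j"
      by (auto simp: memory_gates_def in_set_conv_nth)
    then show "val x 0 (M1 g) = memory R x 0 g"
    proof cases
      case 1
      then show ?thesis
        using val_ins[OF x_ins, of j] load_input[OF C x, of "init_aux R" j] x wf
        by (simp add: ins_def rec_circuit_wf_def)
    next
      case 2
      then show ?thesis
        using val_axs[OF x_ins, of j] load_aux[OF C x, of "init_aux R" j] wf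
        by (simp add: axs_def rec_circuit_wf_def nth_append composite_def)
    qed
  qed
next
  case (Suc t)
  show ?case
  proof (rule val_M1_gate_val[OF Suc.prems])
    fix g assume "g \<in> memory_gates (body R)"
    then show "val x (Suc t) (M1 g) = memory R x (Suc t) g"
      using Suc.IH back_edge_source_gates[OF wf] by (simp add: val_step back_edge_source_def)
  qed
qed

lemma val_halt1: "val x t (H1 (hd (outputs D))) = of_bool (halts_at R x (Suc t))"
proof -
  have "map (val x t \<circ> M1) (halt_gates R) = map (iter_val R x (Suc t)) (halt_gates R)"
    using val_M1 halt_gates_in[OF wf] by (auto simp: iter_val_def)
  then show ?thesis unfolding halts_at_def val_H1[OF val_Cnt1 zero_less_Suc] by (simp only:) simp
qed

text \<open>The bit latches: \<open>Join\<close> is positive as soon as the old bit or the halting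
  bit is \<open>1\<close>. It lags by one update, so during iteration \<open>t + 1\<close> it
  reflects only the iterations up to \<open>t\<close>.\<close>

lemma val_Phase: "val x t Phase = of_bool (\<exists>i\<le>t. halts_at R x i)"
proof (induction t)
  case 0
  then show ?case by (simp add: val_Phase_0 halts_at_def)
next
  case (Suc t)
  then show ?case
    by (auto simp: val_step val_scalars val_halt1 sign_fn_def le_Suc_eq)
qed

section \<open>The second circuit after the handover\<close>

context
  fixes T :: nat and y :: "real list"
  assumes T: "T = (LEAST i. halts_at R x i)" and halts: "\<exists>i. halts_at R x i"
    and y: "y = map (iter_val R x T) (outputs (body R))"
begin

lemma halts_T: "halts_at R x T"
  using halts unfolding T by (rule LeastI_ex)

lemma T_pos: "T > 0"
  using halts_T by (simp add: halts_at_def)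

lemma val_Phase_T: "val x t Phase = of_bool (T \<le> t)"
proof -
  have "(\<exists>i\<le>t. halts_at R x i) \<longleftrightarrow> T \<le> t"
    using halts_T Least_le[of "halts_at R x", folded T] order_trans by blast
  then show ?thesis by (simp add: val_Phase)
qed

text \<open>Time \<open>T - 1\<close> is iteration \<open>T\<close>, in which the first circuit
  halts and its outputs are \<open>y\<close>.\<close>

lemma val_Src:
  assumes g: "g \<in> memory_gates (body R')"
  shows "val x (T - 1) (Src g) = load (body R') y (init_aux R') g"
proof -
  have leny: "length y = length (inputs (body R'))" using dims y by simp
  have lena: "length (init_aux R') = length (auxs (body R'))"
    using wf' by (simp add: rec_circuit_wf_def)
  from g consider j where "j < length (inputs (body R'))" "g = inputs (body R') ! j"
    | j where "j < length (auxs (body R'))" "g = auxs (body R') ! j"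
    by (auto simp: memory_gates_def in_set_conv_nth)
  then show ?thesis
  proof cases
    case 1
    have "outputs (body R) ! j \<in> gates (body R)"
      using 1 dims nth_mem[of j "outputs (body R)"] C
      by (auto simp: circuit_over_def gates_labelled_def)
    then have "val x (T - 1) (Src g) = y ! j"
      using 1 g handover[of j] dims
      by (simp add: val_inner label_op_def val_M1 y iter_val_def)
    with 1 load_input[OF C' leny lena, of j] leny show ?thesis by simp
  next
    case 2
    have "g \<notin> set (inputs (body R'))"
      using nth_mem[OF 2(1)] 2(2) C'
      by (auto simp: circuit_over_def gates_labelled_def)
    moreover have "map_of (zip (auxs (body R')) (init_aux R')) g = Some (init_aux R' ! j)"
      using 2 map_of_zip_nth[OF lena[symmetric], of j] C' lena by (simp add: circuit_over_def)
    ultimately have "val x (T - 1) (Src g) = init_aux R' ! j"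
      using g by (simp add: val_inner label_op_def)
    with 2 load_aux[OF C' leny lena, of j] lena show ?thesis by simp
  qed
qed

lemma val_M2:
  "g \<in> gates (body R') \<Longrightarrow> val x (T + s) (M2 g) = gate_val (body R') (memory R' y s) g"
proof (induction s arbitrary: g)
  case 0
  obtain t where t: "T = Suc t" using T_pos by (cases T) auto
  show ?case
  proof (rule val_M2_gate_val[OF 0])
    fix g assume g: "g \<in> memory_gates (body R')"
    have "val x T (M2 g) = val x t (Upd g)"
      using g by (simp add: t val_step)
    \<comment> \<open>At time \<open>t = T - 1\<close> the phase is still \<open>0\<close>, so
      \<open>Keep\<close> vanishes.\<close>
    also have "\<dots> = val x t (Src g)"
      using g by (simp add: val_Load val_Phase_T t)
    finally show "val x (T + 0) (M2 g) = memory R' y 0 g"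
      using val_Src[OF g] by (simp add: t)
  qed
next
  case (Suc s)
  show ?case
  proof (rule val_M2_gate_val[OF Suc.prems])
    fix g assume g: "g \<in> memory_gates (body R')"
    then show "val x (T + Suc s) (M2 g) = memory R' y (Suc s) g"
      using Suc.IH back_edge_source_gates[OF wf' g]
      by (simp add: val_step back_edge_source_def val_Load val_Phase_T)
  qed
qed

text \<open>With phase \<open>0\<close>, \<open>Inc2\<close> equals \<open>1\<close> whatever the
  old count was; this is the reset to the first iteration number.\<close>

lemma val_Cnt2: "val x (T + s) Cnt2 = real (Suc s)"
proof (induction s)
  case 0
  obtain t where t: "T = Suc t" using T_pos by (cases T) auto
  then show ?case by (simp add: val_step val_scalars val_Phase_T)
next
  case (Suc s)
  then show ?case by (simp add: val_step val_scalars val_Phase_T)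
qed

lemma val_halt2: "val x (T + s) (H2 (hd (outputs D'))) = of_bool (halts_at R' y (Suc s))"
proof -
  have "map (val x (T + s) \<circ> M2) (halt_gates R') = map (iter_val R' y (Suc s)) (halt_gates R')"
    using val_M2 halt_gates_in[OF wf'] by (auto simp: iter_val_def)
  then show ?thesis unfolding halts_at_def val_H2[OF val_Cnt2 zero_less_Suc] by (simp only:) simp
qed

text \<open>Before the handover the second halting circuit sees meaningless arguments and may return
  any real; the phase factor in \<open>Halt\<close> removes it. Afterwards iteration
  \<open>T + s\<close> of the composite is iteration \<open>s\<close> of the second circuit.\<close>

lemma halts_at_composite:
  "halts_at composite x i \<longleftrightarrow> T < i \<and> halts_at R' y (i - T)"
proof (cases i)
  case (Suc t)
  have "halts_at composite x i \<longleftrightarrow> val x t Halt > 0"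
    by (simp add: halts_at_def iter_val_def Suc val_def)
  also have "\<dots> \<longleftrightarrow> T \<le> t \<and> val x t (H2 (hd (outputs D'))) > 0"
    by (simp add: val_scalars val_Phase_T)
  also have "\<dots> \<longleftrightarrow> T \<le> t \<and> halts_at R' y (Suc (t - T))"
    using val_halt2[of "t - T"] by auto
  finally show ?thesis by (auto simp: Suc Suc_diff_le less_Suc_eq_le)
qed (simp add: halts_at_def)

lemma rec_circuit_fun_composite_aux:
  assumes "\<exists>i. halts_at R' y i"
  shows "rec_circuit_fun composite x = rec_circuit_fun R' y"
proof -
  define S where "S = (LEAST i. halts_at R' y i)"
  have S: "halts_at R' y S" unfolding S_def using assms by (rule LeastI_ex)
  then have Spos: "S > 0" by (simp add: halts_at_def)
  have TS: "halts_at composite x (T + S)"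
    using S Spos by (auto simp: halts_at_composite)
  have least: "(LEAST i. halts_at composite x i) = T + S"
  proof (rule Least_equality)
    fix i assume "halts_at composite x i"
    then have "T < i" "halts_at R' y (i - T)" by (simp_all add: halts_at_composite)
    then show "T + S \<le> i" using Least_le[of "halts_at R' y" "i - T"] by (simp add: S_def)
  qed (rule TS)
  have "iter_val composite x (T + S) (to_nat (Res g)) = iter_val R' y S g"
    if g: "g \<in> set (outputs (body R'))" for g
  proof -
    have "g \<in> gates (body R')" using g C' by (auto simp: circuit_over_def gates_labelled_def)
    moreover obtain s where "S = Suc s" using Spos by (cases S) auto
    ultimately show ?thesis
      using val_M2[of g s] val_inner[of "Res g" x "T + s"] g
      by (simp add: iter_val_def val_def[symmetric] label_op_def)
  qed
  then show ?thesis
    using TS assms by (auto simp: rec_circuit_fun_def least S_def)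
qed

end

lemma rec_circuit_fun_composite:
  assumes "rec_circuit_fun R x = Some y" "rec_circuit_fun R' y = Some z"
  shows "rec_circuit_fun composite x = Some z"
proof -
  have "\<exists>i. halts_at R x i" "\<exists>i. halts_at R' y i"
    "y = map (iter_val R x (LEAST i. halts_at R x i)) (outputs (body R))"
    using assms by (auto simp: rec_circuit_fun_def split: if_splits)
  from rec_circuit_fun_composite_aux[OF refl this(1,3,2)] assms(2) show ?thesis by simp
qed

end

text \<open>The factor \<open>6\<close> counts the copy \<open>M2\<close> together with
  \<open>Src\<close>, \<open>Load\<close>, \<open>Keep\<close>, \<open>Upd\<close> and
  \<open>Res\<close>, each indexed by gates of the second body; \<open>13\<close> counts the
  unindexed nodes.\<close>

lemma composite_size:
  "circuit_size composite_body \<le> circuit_size (body R) + circuit_size D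
     + 6 * circuit_size (body R') + circuit_size D' + 13"
proof -
  have fin: "finite (gates (body R))" "finite (gates (body R'))" "finite (gates D)" "finite (gates D')"
    using C C' D D' by (simp_all add: circuit_over_def)
  have mem: "memory_gates (body R') \<subseteq> gates (body R')" "set (outputs (body R')) \<subseteq> gates (body R')"
    using C' by (auto simp: circuit_over_def gates_labelled_def memory_gates_def)
  let ?g = "gates (body R')"
  let ?s = "{One, MinusOne, Phase, Neg, NPhase, Cnt1, Inc1, Cnt2, KeepCnt, Inc2, Join, NextPhase, Halt}"
  have "nodes \<subseteq> M1 ` gates (body R) \<union> H1 ` gates D \<union> M2 ` ?g \<union> H2 ` gates D' \<union>
      Src ` ?g \<union> Load ` ?g \<union> Keep ` ?g \<union> Upd ` ?g \<union> Res ` ?g \<union> ?s" (is "_ \<subseteq> ?N")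
    unfolding nodes_def by (intro Un_mono image_mono order_refl mem)
  then have "card nodes \<le> card ?N"
    using fin by (intro card_mono) simp_all
  also have "\<dots> \<le> card (M1 ` gates (body R)) + card (H1 ` gates D) + card (M2 ` ?g) + card (H2 ` gates D')
      + card (Src ` ?g) + card (Load ` ?g) + card (Keep ` ?g) + card (Upd ` ?g) + card (Res ` ?g) + card ?s"
    by (intro order_trans[OF card_Un_le] add_mono order_refl)
  also have "\<dots> \<le> card (gates (body R)) + card (gates D) + card ?g + card (gates D')
      + card ?g + card ?g + card ?g + card ?g + card ?g + 13"
    using fin by (intro add_mono card_image_le) simp_all
  finally show ?thesis by (simp add: composite_body_def circuit_size_encode) (simp add: circuit_size_def)
qed

end

section \<open>The halting circuits\<close>

text \<open>The first input, the iteration number, is left out of the sum.\<close>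

definition sum_sign_circuit :: "nat \<Rightarrow> circuit" where
  "sum_sign_circuit k = encode_circuit {..<k + 3}
     (\<lambda>g. if g < k then Input else if g = k then Plus else if g = k + 1 then Unary sign_fn else Output)
     (\<lambda>g. if g < k then {} else if g = k then {1..<k} else {g - 1})
     [0..<k] [] [k + 2]"

lemma sum_sign_circuit_simps [simp]:
  "inputs (sum_sign_circuit k) = map to_nat [0..<k]" "auxs (sum_sign_circuit k) = []"
  "outputs (sum_sign_circuit k) = [to_nat (k + 2)]"
  by (simp_all add: sum_sign_circuit_def)

lemma sum_sign_circuit_size: "circuit_size (sum_sign_circuit k) = k + 3"
  by (simp add: sum_sign_circuit_def circuit_size_encode)

lemma
  assumes "sign_fn \<in> A"
  shows sum_sign_circuit_over: "circuit_over A (sum_sign_circuit k)"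
    and sum_sign_circuit_depth: "circuit_depth (sum_sign_circuit k) \<le> 3"
  unfolding sum_sign_circuit_def
  using assms
  \<comment> \<open>Truncated subtraction gives all inputs rank \<open>0\<close> and the last three
    gates the ranks \<open>1\<close>, \<open>2\<close>, \<open>3\<close>.\<close>
  by (intro circuit_over_encode[where rk = "\<lambda>g. Suc g - k"] depth_encode[where rk = "\<lambda>g. Suc g - k"];
      auto simp: arity_ok_def split: if_splits)+

lemma sum_sign_circuit_fun:
  "circuit_fun (sum_sign_circuit (length v + 1)) (c # v) [] = [sign_fn (sum_list v)]"
proof -
  let ?k = "length v + 1"
  let ?\<mu> = "load (sum_sign_circuit ?k) (c # v) []"
  define w where "w g = gate_val (sum_sign_circuit ?k) ?\<mu> (to_nat g)" for g :: nat
  have over: "circuit_over {sign_fn} (sum_sign_circuit ?k)"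
    by (rule sum_sign_circuit_over) simp
  note rec = gate_val_encode[OF over[unfolded sum_sign_circuit_def], folded sum_sign_circuit_def]
  have inp: "w g = (c # v) ! g" if "g < ?k" for g
    using rec[of g ?\<mu>] load_input[OF over, of "c # v" "[]" g] that
    by (simp del: upt_Suc add: w_def arity_ok_def label_op_def)
  have "w ?k = (\<Sum>g = 1..<?k. w g)"
    using rec[of ?k ?\<mu>] by (simp add: w_def arity_ok_def label_op_def)
  also have "\<dots> = (\<Sum>g = 1..<?k. (c # v) ! g)"
    by (intro sum.cong) (auto simp: inp)
  also have "\<dots> = (\<Sum>g = 0..<length v. v ! g)"
    using sum.shift_bounds_Suc_ivl[of "\<lambda>g. (c # v) ! g" 0 "length v"] by simp
  also have "\<dots> = sum_list v" by (simp add: sum_list_sum_nth)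
  finally have "w (?k + 1) = sign_fn (sum_list v)"
    using rec[of "?k + 1" ?\<mu>] by (simp add: w_def arity_ok_def label_op_def)
  then have "w (?k + 2) = sign_fn (sum_list v)"
    using rec[of "?k + 2" ?\<mu>] by (simp add: w_def arity_ok_def label_op_def)
  then show ?thesis by (simp add: circuit_fun_def w_def)
qed

section \<open>Size and depth bounds\<close>

text \<open>Unlike the asymptotic bounds of \<open>FAC\<close>, the following ones hold for every \<open>n\<close>, so they survive
  substituting an arbitrary, possibly bounded, polynomially growing function for \<open>n\<close>.\<close>

definition poly_bounded :: "(nat \<Rightarrow> nat) \<Rightarrow> bool" where
  "poly_bounded s \<longleftrightarrow> (\<exists>k. \<forall>n. s n \<le> (n + 2) ^ k)"

definition polylog_bounded :: "nat \<Rightarrow> (nat \<Rightarrow> nat) \<Rightarrow> bool" where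
  "polylog_bounded i d \<longleftrightarrow> (\<exists>K\<ge>0. \<forall>n. real (d n) \<le> K * ln (real (n + 2)) ^ i)"

lemma poly_bounded_mono: "poly_bounded s \<Longrightarrow> (\<And>n. s' n \<le> s n) \<Longrightarrow> poly_bounded s'"
  unfolding poly_bounded_def by (meson order_trans)

lemma poly_bounded_add:
  assumes "poly_bounded s" "poly_bounded s'"
  shows "poly_bounded (\<lambda>n. s n + s' n)"
proof -
  from assms obtain k l where kl: "\<And>n. s n \<le> (n + 2) ^ k" "\<And>n. s' n \<le> (n + 2) ^ l"
    by (auto simp: poly_bounded_def)
  \<comment> \<open>The doubling is paid for by one more factor \<open>n + 2\<close>, which is at
    least \<open>2\<close>.\<close>
  have "s n + s' n \<le> (n + 2) ^ (k + l + 1)" for n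
  proof -
    have "s n + s' n \<le> (n + 2) ^ (k + l) + (n + 2) ^ (k + l)"
      using kl[of n] power_increasing[of k "k + l" "n + 2"] power_increasing[of l "k + l" "n + 2"]
      by linarith
    then show ?thesis by simp
  qed
  then show ?thesis unfolding poly_bounded_def by blast
qed

lemma poly_bounded_const: "poly_bounded (\<lambda>n. c)"
proof -
  have "c \<le> (n + 2) ^ c" for n
    using power_mono[of 2 "n + 2" c] less_exp[of c] by linarith
  then show ?thesis unfolding poly_bounded_def by blast
qed

lemma poly_bounded_id: "poly_bounded (\<lambda>n. n)"
  unfolding poly_bounded_def by (rule exI[of _ 1]) simp

lemma poly_bounded_comp:
  assumes "poly_bounded s" "poly_bounded m"
  shows "poly_bounded (\<lambda>n. s (m n))"
proof -
  from poly_bounded_add[OF assms(2) poly_bounded_const[of 2]] assms(1)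
  obtain k l where kl: "\<And>n. s n \<le> (n + 2) ^ k" "\<And>n. m n + 2 \<le> (n + 2) ^ l"
    by (auto simp: poly_bounded_def)
  have "s (m n) \<le> (n + 2) ^ (l * k)" for n
    using order_trans[OF kl(1) power_mono[OF kl(2)]] by (simp add: power_mult)
  then show ?thesis by (auto simp: poly_bounded_def)
qed

lemma polylog_bounded_mono: "polylog_bounded i d \<Longrightarrow> (\<And>n. d' n \<le> d n) \<Longrightarrow> polylog_bounded i d'"
  unfolding polylog_bounded_def by (meson of_nat_mono order_trans)

lemma polylog_bounded_add:
  assumes "polylog_bounded i d" "polylog_bounded i d'"
  shows "polylog_bounded i (\<lambda>n. d n + d' n)"
proof -
  from assms obtain K L where
    "K \<ge> 0" "L \<ge> 0" "\<And>n. real (d n) \<le> K * ln (real (n + 2)) ^ i"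
    "\<And>n. real (d' n) \<le> L * ln (real (n + 2)) ^ i"
    by (auto simp: polylog_bounded_def)
  then show ?thesis
    unfolding polylog_bounded_def
    by (intro exI[of _ "K + L"]) (auto simp: distrib_right intro: add_mono)
qed

lemma polylog_bounded_const: "polylog_bounded i (\<lambda>n. c)"
proof -
  have "real c \<le> real c / ln 2 ^ i * ln (real (n + 2)) ^ i" for n
  proof -
    have "ln 2 ^ i \<le> ln (real (n + 2)) ^ i"
      by (intro power_mono) auto
    then have "real c * ln 2 ^ i \<le> real c * ln (real (n + 2)) ^ i"
      by (intro mult_left_mono) auto
    then show ?thesis by (simp add: field_simps)
  qed
  then show ?thesis
    unfolding polylog_bounded_def by (intro exI[of _ "real c / ln 2 ^ i"]) auto
qed

text \<open>The logarithm of \<open>(n + 2) ^ l\<close> is \<open>l * ln (n + 2)\<close>, so a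
  polynomial substitution costs only the factor \<open>l ^ i\<close>.\<close>

lemma polylog_bounded_comp:
  assumes "polylog_bounded i d" "poly_bounded m"
  shows "polylog_bounded i (\<lambda>n. d (m n))"
proof -
  from poly_bounded_add[OF assms(2) poly_bounded_const[of 2]] assms(1)
  obtain K l where K: "K \<ge> 0" "\<And>n. real (d n) \<le> K * ln (real (n + 2)) ^ i"
    and l: "\<And>n. m n + 2 \<le> (n + 2) ^ l"
    by (auto simp: poly_bounded_def polylog_bounded_def)
  have "real (d (m n)) \<le> (K * real l ^ i) * ln (real (n + 2)) ^ i" for n
  proof -
    have "real (m n + 2) \<le> real (n + 2) ^ l"
      using l[of n] by (metis of_nat_le_iff of_nat_power)
    then have "ln (real (m n + 2)) \<le> ln (real (n + 2) ^ l)"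
      by (subst ln_le_cancel_iff) auto
    also have "\<dots> = real l * ln (real (n + 2))"
      by (rule ln_realpow)
    finally have "ln (real (m n + 2)) ^ i \<le> (real l * ln (real (n + 2))) ^ i"
      by (intro power_mono) auto
    then have "K * ln (real (m n + 2)) ^ i \<le> K * (real l * ln (real (n + 2))) ^ i"
      using K(1) by (rule mult_left_mono)
    with K(2)[of "m n"] show ?thesis by (simp add: power_mult_distrib mult.assoc)
  qed
  with K(1) show ?thesis
    unfolding polylog_bounded_def by (intro exI[of _ "K * real l ^ i"]) auto
qed

text \<open>The finitely many exceptional arguments are absorbed by adding their ratios to the
  constant. This needs \<open>h\<close> positive everywhere, which holds for powers of
  \<open>n + 2\<close> and of its logarithm.\<close>

lemma bigo_everywhere:
  fixes f h :: "nat \<Rightarrow> real"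
  assumes "f \<in> O(h)" and pos: "\<And>n. h n > 0"
  shows "\<exists>K\<ge>0. \<forall>n. f n \<le> K * h n"
proof -
  from assms(1) obtain c where c: "c > 0" "\<forall>\<^sub>F n in at_top. norm (f n) \<le> c * norm (h n)"
    by (elim landau_o.bigE)
  then obtain N where N: "\<And>n. n \<ge> N \<Longrightarrow> norm (f n) \<le> c * norm (h n)"
    by (auto simp: eventually_at_top_linorder)
  define K where "K = c + (\<Sum>n<N. \<bar>f n\<bar> / h n)"
  have S: "(\<Sum>n<N. \<bar>f n\<bar> / h n) \<ge> 0"
    using pos by (intro sum_nonneg) (simp add: less_imp_le)
  have "f n \<le> K * h n" for n
  proof (cases "n \<ge> N")
    case True
    have "f n \<le> c * h n" using N[OF True] pos[of n] by simp
    also have "\<dots> \<le> K * h n" using S pos[of n] by (intro mult_right_mono) (auto simp: K_def)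
    finally show ?thesis .
  next
    case False
    have "\<bar>f n\<bar> / h n \<le> (\<Sum>n<N. \<bar>f n\<bar> / h n)"
      using False pos by (intro member_le_sum) (auto simp: less_imp_le)
    also have "\<dots> \<le> K" using c(1) by (simp add: K_def)
    finally show ?thesis using pos[of n] by (simp add: field_simps)
  qed
  moreover have "K \<ge> 0" using S c(1) by (simp add: K_def)
  ultimately show ?thesis by blast
qed

lemma poly_bounded_iff:
  "poly_bounded s \<longleftrightarrow> (\<exists>k::nat. (\<lambda>n. real (s n)) \<in> O(\<lambda>n. real n ^ k))"
proof
  assume "poly_bounded s"
  then obtain k where k: "\<And>n. s n \<le> (n + 2) ^ k" by (auto simp: poly_bounded_def)
  have "norm (real (s n)) \<le> 3 ^ k * norm (real n ^ k)" if "n \<ge> 1" for n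
  proof -
    \<comment> \<open>For \<open>n \<ge> 1\<close>, \<open>n + 2\<close> is at most
      \<open>3 * n\<close>.\<close>
    have "s n \<le> (3 * n) ^ k"
      using that by (intro order_trans[OF k] power_mono) auto
    then have "real (s n) \<le> real ((3 * n) ^ k)"
      by (rule of_nat_mono)
    then show ?thesis by (simp add: power_mult_distrib)
  qed
  then have "(\<lambda>n. real (s n)) \<in> O(\<lambda>n. real n ^ k)"
    by (intro bigoI[of _ "3 ^ k"] eventually_at_top_linorderI[of 1]) auto
  then show "\<exists>k::nat. (\<lambda>n. real (s n)) \<in> O(\<lambda>n. real n ^ k)" ..
next
  assume "\<exists>k::nat. (\<lambda>n. real (s n)) \<in> O(\<lambda>n. real n ^ k)"
  then obtain k where "(\<lambda>n. real (s n)) \<in> O(\<lambda>n. real n ^ k)" ..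
  also have "(\<lambda>n. real n ^ k) \<in> O(\<lambda>n. real (n + 2) ^ k)"
    by (intro landau_o.big_mono always_eventually) (auto intro!: power_mono)
  finally obtain K where K: "\<And>n. real (s n) \<le> K * real (n + 2) ^ k"
    using bigo_everywhere[of "\<lambda>n. real (s n)" "\<lambda>n. real (n + 2) ^ k"] by auto
  \<comment> \<open>A constant factor is traded for \<open>m\<close> further factors
    \<open>n + 2\<close>, each at least \<open>2\<close>.\<close>
  obtain m where m: "K < 2 ^ m" using real_arch_pow[of 2 K] by auto
  have "s n \<le> (n + 2) ^ (m + k)" for n
  proof -
    have "2 ^ m \<le> real (n + 2) ^ m" by (intro power_mono) auto
    with m have "K \<le> real (n + 2) ^ m" by linarith
    then have "K * real (n + 2) ^ k \<le> real (n + 2) ^ m * real (n + 2) ^ k"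
      by (intro mult_right_mono) auto
    from order_trans[OF K this] have "real (s n) \<le> real ((n + 2) ^ (m + k))"
      by (simp only: power_add of_nat_mult of_nat_power)
    then show ?thesis by (simp only: of_nat_le_iff)
  qed
  then show "poly_bounded s" by (auto simp: poly_bounded_def)
qed

lemma polylog_bounded_iff:
  "polylog_bounded i d \<longleftrightarrow> (\<lambda>n. real (d n)) \<in> O(\<lambda>n. ln (real n) ^ i)"
proof
  assume "polylog_bounded i d"
  then obtain K where K: "K \<ge> 0" "\<And>n. real (d n) \<le> K * ln (real (n + 2)) ^ i"
    by (auto simp: polylog_bounded_def)
  have "norm (real (d n)) \<le> (K * 2 ^ i) * norm (ln (real n) ^ i)" if n: "n \<ge> 2" for n
  proof -
    \<comment> \<open>From \<open>n = 2\<close> on the shift at most squares the argument, hence at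
      most doubles its logarithm; this yields the factor \<open>2 ^ i\<close>.\<close>
    have "n + 2 \<le> n * n" using n mult_le_mono1[of 2 n n] by linarith
    then have "real (n + 2) \<le> real n ^ 2"
      by (metis of_nat_le_iff of_nat_mult power2_eq_square)
    then have "ln (real (n + 2)) \<le> ln (real n ^ 2)"
      using n by (subst ln_le_cancel_iff) auto
    also have "\<dots> = 2 * ln (real n)"
      using n by (simp add: ln_realpow)
    finally have "ln (real (n + 2)) ^ i \<le> (2 * ln (real n)) ^ i"
      by (intro power_mono) auto
    then have "K * ln (real (n + 2)) ^ i \<le> K * (2 * ln (real n)) ^ i"
      using K(1) by (rule mult_left_mono)
    with K(2)[of n] have "real (d n) \<le> (K * 2 ^ i) * ln (real n) ^ i"
      by (simp add: power_mult_distrib mult.assoc)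
    then show ?thesis using n by simp
  qed
  then show "(\<lambda>n. real (d n)) \<in> O(\<lambda>n. ln (real n) ^ i)"
    by (intro bigoI[of _ "K * 2 ^ i"] eventually_at_top_linorderI[of 2]) auto
next
  assume "(\<lambda>n. real (d n)) \<in> O(\<lambda>n. ln (real n) ^ i)"
  also have "(\<lambda>n. ln (real n) ^ i) \<in> O(\<lambda>n. ln (real (n + 2)) ^ i)"
    by (intro landau_o.big_mono eventually_at_top_linorderI[of 1])
      (auto simp: norm_power intro!: power_mono)
  finally show "polylog_bounded i d"
    using bigo_everywhere[of "\<lambda>n. real (d n)" "\<lambda>n. ln (real (n + 2)) ^ i"]
    by (auto simp: polylog_bounded_def)
qed

lemma FAC_iff:
  "C \<in> FAC i A \<longleftrightarrow> (\<forall>n. circuit_over A (C n) \<and> length (inputs (C n)) = n) \<and>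
     poly_bounded (\<lambda>n. circuit_size (C n)) \<and> polylog_bounded i (\<lambda>n. circuit_depth (C n))"
  by (simp add: FAC_def poly_bounded_iff polylog_bounded_iff)

lemma sum_sign_circuit_FAC:
  assumes "sign_fn \<in> A"
  shows "sum_sign_circuit \<in> FAC i A"
  unfolding FAC_iff sum_sign_circuit_size
  using sum_sign_circuit_over[OF assms] poly_bounded_add[OF poly_bounded_id poly_bounded_const]
    polylog_bounded_mono[OF polylog_bounded_const[of i 3] sum_sign_circuit_depth[OF assms]]
  by simp

text \<open>Output and halting gates are gates, so their numbers inherit the polynomial size
  bound.\<close>

lemma distinct_subset_length_le_size:
  assumes "circuit_over A C" "distinct gs" "set gs \<subseteq> gates C"
  shows "length gs \<le> circuit_size C"
proof -
  have "card (set gs) \<le> card (gates C)"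
    using assms by (intro card_mono) (auto simp: circuit_over_def)
  with assms(2) show ?thesis by (simp add: circuit_size_def distinct_card)
qed

theorem theorem1:
  fixes i :: nat and A :: "(real \<Rightarrow> real) set"
    and f f' :: "nat \<Rightarrow> real list \<Rightarrow> real list"
    and n' :: "nat \<Rightarrow> nat"
  assumes "f \<in> rec_class (FAC i (A \<union> {sign_fn})) (FAC i A)"
    and "f' \<in> rec_class (FAC i (A \<union> {sign_fn})) (FAC i A)"
    and "\<And>n x. length x = n \<Longrightarrow> length (f n x) = n' n"
  shows "(\<lambda>n. f' (n' n) \<circ> f n) \<in> rec_class (FAC i (A \<union> {sign_fn})) (FAC i (A \<union> {sign_fn}))"
proof -
  let ?A = "A \<union> {sign_fn}"
  have unpack: "\<exists>R D. (\<forall>n. rec_circuit_wf (R n)) \<and> (\<lambda>n. body (R n)) \<in> FAC i A \<and> D \<in> FAC i ?A \<and>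
      (\<forall>n. decides_halting (D (length (halt_gates (R n)) + 1)) (R n)) \<and>
      (\<forall>n x. length x = n \<longrightarrow> rec_circuit_fun (R n) x = Some (g n x))"
    if g: "g \<in> rec_class (FAC i ?A) (FAC i A)" for g
  proof -
    from g obtain R D where
      R: "\<And>n. rec_circuit_wf (R n)" "(\<lambda>n. body (R n)) \<in> FAC i A"
        "\<And>n x. length x = n \<Longrightarrow> rec_circuit_fun (R n) x = Some (g n x)"
      and D: "D \<in> FAC i ?A" "\<And>k. auxs (D k) = []"
        "\<And>n i v. i > 0 \<Longrightarrow> length v = length (halt_gates (R n)) \<Longrightarrow>
           circuit_fun (D (length v + 1)) (real i # v) [] = [of_bool (halt_fun (R n) i v)]"
      unfolding rec_class_def by blast
    have "decides_halting (D (length (halt_gates (R n)) + 1)) (R n)" for n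
      unfolding decides_halting_def using D D(3)[where n = n] by (auto simp: FAC_iff)
    with R D(1) show ?thesis by blast
  qed
  from unpack[OF assms(1)] obtain R D where
    R: "\<And>n. rec_circuit_wf (R n)" "(\<lambda>n. body (R n)) \<in> FAC i A" and D: "D \<in> FAC i ?A"
    and halt: "\<And>n. decides_halting (D (length (halt_gates (R n)) + 1)) (R n)"
    and R_fun: "\<And>n x. length x = n \<Longrightarrow> rec_circuit_fun (R n) x = Some (f n x)"
    by blast
  from unpack[OF assms(2)] obtain R' D' where
    R': "\<And>n. rec_circuit_wf (R' n)" "(\<lambda>n. body (R' n)) \<in> FAC i A" and D': "D' \<in> FAC i ?A"
    and halt': "\<And>n. decides_halting (D' (length (halt_gates (R' n)) + 1)) (R' n)"
    and R'_fun: "\<And>n x. length x = n \<Longrightarrow> rec_circuit_fun (R' n) x = Some (f' n x)"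
    by blast
  define p where "p n = length (halt_gates (R n)) + 1" for n
  define p' where "p' n = length (halt_gates (R' n)) + 1" for n
  have over: "circuit_over ?A (body (R n))" "circuit_over ?A (body (R' n))"
    "circuit_over ?A (D n)" "circuit_over ?A (D' n)" for n
    using R(2) R'(2) D D' by (auto simp: FAC_iff intro: circuit_over_mono)
  have inputs: "length (inputs (body (R n))) = n" "length (inputs (body (R' n))) = n" for n
    using R(2) R'(2) by (auto simp: FAC_iff)
  \<comment> \<open>The output dimension is a property of the body, so a run on one input, here the
    zero vector, determines it.\<close>
  have outs: "length (outputs (body (R n))) = n' n" for n
  proof -
    have "rec_circuit_fun (R n) (replicate n 0) = Some (f n (replicate n 0))"
      by (rule R_fun) simp
    then have "length (outputs (body (R n))) = length (f n (replicate n 0))"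
      by (auto simp: rec_circuit_fun_def split: if_splits dest: arg_cong[of _ _ length])
    with assms(3)[of "replicate n 0" n] show ?thesis by simp
  qed
  have comp: "composition ?A (R n) (R' (n' n)) (D (p n)) (D' (p' (n' n)))" for n
    by unfold_locales (use over R(1) R'(1) halt halt' outs inputs in \<open>auto simp: p_def p'_def\<close>)
  define E where "E n = composition.composite (R n) (R' (n' n)) (D (p n)) (D' (p' (n' n)))" for n
  note E_body = composition.composite_simps[OF comp, folded E_def]

  have sizes: "poly_bounded (\<lambda>n. circuit_size (body (R n)))"
    "poly_bounded (\<lambda>n. circuit_size (body (R' n)))"
    "poly_bounded (\<lambda>n. circuit_size (D n))" "poly_bounded (\<lambda>n. circuit_size (D' n))"
    using R(2) R'(2) D D' by (simp_all add: FAC_iff)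
  have depths: "polylog_bounded i (\<lambda>n. circuit_depth (body (R n)))"
    "polylog_bounded i (\<lambda>n. circuit_depth (body (R' n)))"
    "polylog_bounded i (\<lambda>n. circuit_depth (D n))" "polylog_bounded i (\<lambda>n. circuit_depth (D' n))"
    using R(2) R'(2) D D' by (simp_all add: FAC_iff)
  \<comment> \<open>The index of the second circuit is the number of output gates of the
    first.\<close>
  have n': "poly_bounded n'"
  proof (rule poly_bounded_mono[OF sizes(1)])
    show "n' n \<le> circuit_size (body (R n))" for n
      unfolding outs[symmetric] using over(1)[of n]
      by (intro distinct_subset_length_le_size) (auto simp: circuit_over_def gates_labelled_def)
  qed
  have p: "poly_bounded p"
  proof (rule poly_bounded_mono[OF poly_bounded_add[OF sizes(1) poly_bounded_const]])
    show "p n \<le> circuit_size (body (R n)) + 1" for n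
      using distinct_subset_length_le_size[OF over(1)] R(1)[of n]
      by (simp add: p_def rec_circuit_wf_def)
  qed
  have p': "poly_bounded p'"
  proof (rule poly_bounded_mono[OF poly_bounded_add[OF sizes(2) poly_bounded_const]])
    show "p' n \<le> circuit_size (body (R' n)) + 1" for n
      using distinct_subset_length_le_size[OF over(2)] R'(1)[of n]
      by (simp add: p'_def rec_circuit_wf_def)
  qed
  note args = n' p poly_bounded_comp[OF p' n']

  have "(\<lambda>n. body (E n)) \<in> FAC i ?A"
    unfolding FAC_iff
  proof (intro conjI allI)
    fix n
    show "circuit_over ?A (body (E n))"
      unfolding E_body by (rule composition.composite_over[OF comp])
    show "length (inputs (body (E n))) = n"
      unfolding E_body
      by (simp add: composition.composite_body_simps[OF comp] composition.ins_def[OF comp] inputs)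
  next
    show "poly_bounded (\<lambda>n. circuit_size (body (E n)))"
      unfolding E_body
    proof (rule poly_bounded_mono[OF _ composition.composite_size[OF comp]])
      have six: "poly_bounded (\<lambda>n. 6 * circuit_size (body (R' (n' n))))"
        using poly_bounded_comp[where s = "\<lambda>k. 6 * k", OF _ poly_bounded_comp[OF sizes(2) n']]
          poly_bounded_add[OF poly_bounded_id] poly_bounded_id
        by (simp add: numeral_eq_Suc)
      show "poly_bounded (\<lambda>n. circuit_size (body (R n)) + circuit_size (D (p n))
          + 6 * circuit_size (body (R' (n' n))) + circuit_size (D' (p' (n' n))) + 13)"
        using poly_bounded_comp[OF sizes(3) p] poly_bounded_comp[OF sizes(4) args(3)]
        by (intro poly_bounded_add poly_bounded_const sizes(1) six)
    qed
    show "polylog_bounded i (\<lambda>n. circuit_depth (body (E n)))"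
      unfolding E_body
    proof (rule polylog_bounded_mono[OF _ composition.composite_depth[OF comp]])
      show "polylog_bounded i (\<lambda>n. circuit_depth (body (R n)) + circuit_depth (body (R' (n' n)))
          + circuit_depth (D (p n)) + circuit_depth (D' (p' (n' n))) + 4)"
        using polylog_bounded_comp[OF depths(2) n'] polylog_bounded_comp[OF depths(3) p]
          polylog_bounded_comp[OF depths(4) args(3)]
        by (intro polylog_bounded_add polylog_bounded_const depths(1))
    qed
  qed
  moreover have "rec_circuit_wf (E n)" for n
    unfolding E_def by (rule composition.composite_wf[OF comp])
  moreover have "circuit_fun (sum_sign_circuit (length v + 1)) (real j # v) []
      = [of_bool (halt_fun (E n) j v)]" for n j v
    by (simp only: sum_sign_circuit_fun E_body) (simp add: sign_fn_def)
  moreover have "rec_circuit_fun (E n) x = Some ((f' (n' n) \<circ> f n) x)" if "length x = n" for n x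
    unfolding E_def
    using composition.rec_circuit_fun_composite[OF comp, of x n] that inputs(1)
      R_fun[OF that] R'_fun[OF assms(3)[OF that]] by simp
  moreover have "sum_sign_circuit \<in> FAC i ?A"
    by (rule sum_sign_circuit_FAC) simp
  ultimately show ?thesis
    unfolding rec_class_def mem_Collect_eq
    by (intro exI[of _ E] conjI bexI[of _ sum_sign_circuit]) auto
qed

end
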